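(* Let $M$ be a $2m$-dimensional almost Hermitian manifold with (positive) definite metric $g$, where $m>1$. Suppose that for each point $p\in M$ there exists a constant $c(p)$ such that at least one of the following holds: (i) $|\mathrm{Re}\,H^{\mathbb{C}}(\alpha)|\le c(p)$ for every holomorphic 2-plane $\alpha$ in $(T_pM)^{\mathbb{C}}$ of signature $(+,+)$; (ii) $|\mathrm{Im}\,H^{\mathbb{C}}(\alpha)|\le c(p)$ for every holomorphic 2-plane $\alpha$ in $(T_pM)^{\mathbb{C}}$ of signature $(+,+)$. Then $M$ is of pointwise constant holomorphic sectional curvature.
   Context: An almost Hermitian manifold is a smooth manifold $M$ with a metric tensor $g$ (here Riemannian) and an almost complex structure $J$ satisfying $J^2=-\mathrm{id}$ and $g(X,Y)=g(JX,JY)$. Let $\nabla$ be the Levi-Civita connection, $R(X,Y)=[\nabla_X,\nabla_Y]-\nabla_{[X,Y]}$ the curvature tensor, and $R(X,Y,Z,U)=g(R(X,Y)Z,U)$. For a unit vector $X\in T_pM$ the holomorphic sectional curvature is $H(X)=R(X,JX,JX,X)$; $M$ is of pointwise constant holomorphic sectional curvature if for every $p\in M$ there is a constant $k(p)$ such that $H(X)=k(p)$ for every unit vector $X\in T_pM$. Let $(T_pM)^{\mathbb{C}}=T_pM\otimes_{\mathbb{R}}\mathbb{C}$; $g$, $J$ and $R$ are extended complex (multi)linearly to $(T_pM)^{\mathbb{C}}$ (so $g$ becomes a complex symmetric bilinear form), the extension of $R$ being denoted $R^{\mathbb{C}}$. A 2-plane $\alpha$ in $(T_pM)^{\mathbb{C}}$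 (a two-dimensional complex subspace) is nondegenerate if the restriction of $g$ to it is nondegenerate, and holomorphic if $\alpha=J\alpha$. It is of signature $(+,+)$ if it is spanned by vectors $X,Y$ with $g(X,X)=g(Y,Y)=1$, $g(X,Y)=0$. For a nondegenerate 2-plane $\alpha$ spanned by $X,Y\in(T_pM)^{\mathbb{C}}$, $$K^{\mathbb{C}}(\alpha)=\frac{R^{\mathbb{C}}(X,Y,Y,X)}{g(X,X)g(Y,Y)-g(X,Y)^2},$$ and for holomorphic $\alpha$ one writes $H^{\mathbb{C}}(\alpha)=K^{\mathbb{C}}(\alpha)$. *)

theory Defs
  imports "HOL-Analysis.Analysis" "HOL-Library.Function_Algebras"
begin

section \<open>Functions as a real vector space\<close>

instantiation "fun" :: (type, real_vector) real_vector
begin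

definition scaleR_fun :: "real \<Rightarrow> ('a \<Rightarrow> 'b) \<Rightarrow> 'a \<Rightarrow> 'b"
  where "scaleR_fun c f = (\<lambda>x. c *\<^sub>R f x)"

instance
  by standard (auto simp: scaleR_fun_def fun_eq_iff scaleR_add_right scaleR_add_left)

end

definition linear_between :: "'v::real_vector set \<Rightarrow> 'w::real_vector set \<Rightarrow> ('v \<Rightarrow> 'w) \<Rightarrow> bool"
  where "linear_between S T F \<longleftrightarrow>
    F ` S \<subseteq> T \<and>
    (\<forall>u\<in>S. \<forall>v\<in>S. \<forall>a b. F (a *\<^sub>R u + b *\<^sub>R v) = a *\<^sub>R F u + b *\<^sub>R F v)"


section \<open>Smooth manifolds\<close>

text \<open>
  Maps of class \<open>C\<^sup>k\<close> and \<open>C\<^sup>\<infinity>\<close>; these are only used for open \<open>S\<close> in finite dimension, where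
  smoothness of all directional derivatives is the usual notion.
\<close>

fun higher_differentiable_on ::
    "'v::real_normed_vector set \<Rightarrow> ('v \<Rightarrow> 'w::real_normed_vector) \<Rightarrow> nat \<Rightarrow> bool"
  where
    "higher_differentiable_on S f 0 \<longleftrightarrow> continuous_on S f"
  | "higher_differentiable_on S f (Suc k) \<longleftrightarrow>
      (\<forall>x\<in>S. f differentiable at x) \<and>
      (\<forall>v. higher_differentiable_on S (\<lambda>x. frechet_derivative f (at x) v) k)"

definition smooth_on ::
    "'v::real_normed_vector set \<Rightarrow> ('v \<Rightarrow> 'w::real_normed_vector) \<Rightarrow> bool"
  where "smooth_on S f \<longleftrightarrow> (\<forall>k. higher_differentiable_on S f k)"

text \<open>A chart is a pair of its domain and its coordinate map; the model space is \<open>'e\<close>.\<close>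

type_synonym ('a, 'e) chart = "'a set \<times> ('a \<Rightarrow> 'e)"

definition smooth_atlas :: "'a topology \<Rightarrow> ('a, 'e::euclidean_space) chart set \<Rightarrow> bool"
  where "smooth_atlas M \<A> \<longleftrightarrow>
    (\<Union>(U, \<phi>)\<in>\<A>. U) = topspace M \<and>
    (\<forall>(U, \<phi>)\<in>\<A>. openin M U \<and> open (\<phi> ` U) \<and>
       homeomorphic_map (subtopology M U) (top_of_set (\<phi> ` U)) \<phi>) \<and>
    (\<forall>(U, \<phi>)\<in>\<A>. \<forall>(V, \<psi>)\<in>\<A>. smooth_on (\<phi> ` (U \<inter> V)) (\<psi> \<circ> inv_into U \<phi>))"

definition smooth_manifold :: "'a topology \<Rightarrow> ('a, 'e::euclidean_space) chart set \<Rightarrow> bool"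
  where "smooth_manifold M \<A> \<longleftrightarrow>
    Hausdorff_space M \<and> second_countable M \<and> smooth_atlas M \<A>"

text \<open>
  Locally defined functions and vector fields are represented by total functions together with
  the open set on which they are considered.
\<close>

definition smooth_fun :: "('a, 'e::euclidean_space) chart set \<Rightarrow> 'a set \<Rightarrow> ('a \<Rightarrow> real) \<Rightarrow> bool"
  where "smooth_fun \<A> U f \<longleftrightarrow>
    (\<forall>(V, \<phi>)\<in>\<A>. smooth_on (\<phi> ` (U \<inter> V)) (f \<circ> inv_into V \<phi>))"

definition smooth_near ::
    "'a topology \<Rightarrow> ('a, 'e::euclidean_space) chart set \<Rightarrow> 'a \<Rightarrow> ('a \<Rightarrow> real) \<Rightarrow> bool"
  where "smooth_near M \<A> p f \<longleftrightarrow> (\<exists>U. openin M U \<and> p \<in> U \<and> smooth_fun \<A> U f)"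

text \<open>
  Tangent vectors at \<open>p\<close> are the derivations of the algebra of germs at \<open>p\<close> of smooth functions.
  They are extended by 0 to functions that are not smooth near \<open>p\<close>, so that equality of tangent
  vectors is equality of functionals.
\<close>

type_synonym 'a tvec = "('a \<Rightarrow> real) \<Rightarrow> real"

definition tangent_space ::
    "'a topology \<Rightarrow> ('a, 'e::euclidean_space) chart set \<Rightarrow> 'a \<Rightarrow> 'a tvec set"
  where "tangent_space M \<A> p = {v.
    (\<forall>f. \<not> smooth_near M \<A> p f \<longrightarrow> v f = 0) \<and>
    (\<forall>f h. smooth_near M \<A> p f \<longrightarrow> smooth_near M \<A> p h \<longrightarrow>
       (\<forall>a b. v (\<lambda>q. a * f q + b * h q) = a * v f + b * v h) \<and>
       v (\<lambda>q. f q * h q) = v f * h p + f p * v h \<and>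
       ((\<exists>U. openin M U \<and> p \<in> U \<and> (\<forall>q\<in>U. f q = h q)) \<longrightarrow> v f = v h))}"

definition vector_field ::
    "'a topology \<Rightarrow> ('a, 'e::euclidean_space) chart set \<Rightarrow> 'a set \<Rightarrow> ('a \<Rightarrow> 'a tvec) \<Rightarrow> bool"
  where "vector_field M \<A> U X \<longleftrightarrow>
    (\<forall>p\<in>U. X p \<in> tangent_space M \<A> p) \<and>
    (\<forall>V f. openin M V \<longrightarrow> V \<subseteq> U \<longrightarrow> smooth_fun \<A> V f \<longrightarrow> smooth_fun \<A> V (\<lambda>p. X p f))"

definition lie_bracket ::
    "'a topology \<Rightarrow> ('a, 'e::euclidean_space) chart set \<Rightarrow>
      ('a \<Rightarrow> 'a tvec) \<Rightarrow> ('a \<Rightarrow> 'a tvec) \<Rightarrow> 'a \<Rightarrow> 'a tvec"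
  where "lie_bracket M \<A> X Y p = (\<lambda>f.
    if smooth_near M \<A> p f then X p (\<lambda>q. Y q f) - Y p (\<lambda>q. X q f) else 0)"


section \<open>Almost Hermitian structures\<close>

definition riemannian_metric ::
    "'a topology \<Rightarrow> ('a, 'e::euclidean_space) chart set \<Rightarrow>
      ('a \<Rightarrow> 'a tvec \<Rightarrow> 'a tvec \<Rightarrow> real) \<Rightarrow> bool"
  where "riemannian_metric M \<A> g \<longleftrightarrow>
    (\<forall>p\<in>topspace M.
       (\<forall>v\<in>tangent_space M \<A> p.
          linear_between (tangent_space M \<A> p) UNIV (g p v) \<and>
          (\<forall>w\<in>tangent_space M \<A> p. g p v w = g p w v) \<and>
          (v \<noteq> 0 \<longrightarrow> g p v v > 0))) \<and>
    (\<forall>U X Y. openin M U \<longrightarrow> vector_field M \<A> U X \<longrightarrow> vector_field M \<A> U Y \<longrightarrow>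
       smooth_fun \<A> U (\<lambda>p. g p (X p) (Y p)))"

definition almost_complex_structure ::
    "'a topology \<Rightarrow> ('a, 'e::euclidean_space) chart set \<Rightarrow> ('a \<Rightarrow> 'a tvec \<Rightarrow> 'a tvec) \<Rightarrow> bool"
  where "almost_complex_structure M \<A> J \<longleftrightarrow>
    (\<forall>p\<in>topspace M.
       linear_between (tangent_space M \<A> p) (tangent_space M \<A> p) (J p) \<and>
       (\<forall>v\<in>tangent_space M \<A> p. J p (J p v) = - v)) \<and>
    (\<forall>U X. openin M U \<longrightarrow> vector_field M \<A> U X \<longrightarrow> vector_field M \<A> U (\<lambda>p. J p (X p)))"

definition almost_hermitian_manifold ::
    "'a topology \<Rightarrow> ('a, 'e::euclidean_space) chart set \<Rightarrow>
      ('a \<Rightarrow> 'a tvec \<Rightarrow> 'a tvec \<Rightarrow> real) \<Rightarrow> ('a \<Rightarrow> 'a tvec \<Rightarrow> 'a tvec) \<Rightarrow> bool"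
  where "almost_hermitian_manifold M \<A> g J \<longleftrightarrow>
    smooth_manifold M \<A> \<and> riemannian_metric M \<A> g \<and> almost_complex_structure M \<A> J \<and>
    (\<forall>p\<in>topspace M. \<forall>v\<in>tangent_space M \<A> p. \<forall>w\<in>tangent_space M \<A> p.
       g p v w = g p (J p v) (J p w))"


section \<open>Levi-Civita connection and curvature\<close>

text \<open>
  An affine connection is given by the covariant derivatives \<open>D p v Y\<close> at \<open>p\<close>, in the direction of
  the tangent vector \<open>v\<close> at \<open>p\<close>, of vector fields \<open>Y\<close> defined on a neighbourhood of \<open>p\<close>; thus
  \<open>(\<nabla>\<^sub>X Y)\<^sub>p\<close> is \<open>D p (X p) Y\<close>.
\<close>

definition affine_connection ::
    "'a topology \<Rightarrow> ('a, 'e::euclidean_space) chart set \<Rightarrow>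
      ('a \<Rightarrow> 'a tvec \<Rightarrow> ('a \<Rightarrow> 'a tvec) \<Rightarrow> 'a tvec) \<Rightarrow> bool"
  where "affine_connection M \<A> D \<longleftrightarrow>
    (\<forall>U Y. openin M U \<longrightarrow> vector_field M \<A> U Y \<longrightarrow>
       (\<forall>p\<in>U. linear_between (tangent_space M \<A> p) (tangent_space M \<A> p) (\<lambda>v. D p v Y)) \<and>
       (\<forall>X. vector_field M \<A> U X \<longrightarrow> vector_field M \<A> U (\<lambda>p. D p (X p) Y)) \<and>
       (\<forall>Z. vector_field M \<A> U Z \<longrightarrow> (\<forall>p\<in>U. \<forall>v\<in>tangent_space M \<A> p.
          D p v (\<lambda>q. Y q + Z q) = D p v Y + D p v Z \<and>
          ((\<forall>q\<in>U. Y q = Z q) \<longrightarrow> D p v Y = D p v Z))) \<and>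
       (\<forall>f. smooth_fun \<A> U f \<longrightarrow> (\<forall>p\<in>U. \<forall>v\<in>tangent_space M \<A> p.
          D p v (\<lambda>q. f q *\<^sub>R Y q) = v f *\<^sub>R Y p + f p *\<^sub>R D p v Y)))"

definition levi_civita_connection ::
    "'a topology \<Rightarrow> ('a, 'e::euclidean_space) chart set \<Rightarrow>
      ('a \<Rightarrow> 'a tvec \<Rightarrow> 'a tvec \<Rightarrow> real) \<Rightarrow>
      ('a \<Rightarrow> 'a tvec \<Rightarrow> ('a \<Rightarrow> 'a tvec) \<Rightarrow> 'a tvec) \<Rightarrow> bool"
  where "levi_civita_connection M \<A> g D \<longleftrightarrow>
    affine_connection M \<A> D \<and>
    (\<forall>U X Y. openin M U \<longrightarrow> vector_field M \<A> U X \<longrightarrow> vector_field M \<A> U Y \<longrightarrow>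
       (\<forall>p\<in>U. D p (X p) Y - D p (Y p) X = lie_bracket M \<A> X Y p)) \<and>
    (\<forall>U Y Z. openin M U \<longrightarrow> vector_field M \<A> U Y \<longrightarrow> vector_field M \<A> U Z \<longrightarrow>
       (\<forall>p\<in>U. \<forall>v\<in>tangent_space M \<A> p.
          v (\<lambda>q. g q (Y q) (Z q)) = g p (D p v Y) (Z p) + g p (Y p) (D p v Z)))"

definition curvature_operator ::
    "'a topology \<Rightarrow> ('a, 'e::euclidean_space) chart set \<Rightarrow>
      ('a \<Rightarrow> 'a tvec \<Rightarrow> ('a \<Rightarrow> 'a tvec) \<Rightarrow> 'a tvec) \<Rightarrow>
      ('a \<Rightarrow> 'a tvec) \<Rightarrow> ('a \<Rightarrow> 'a tvec) \<Rightarrow> ('a \<Rightarrow> 'a tvec) \<Rightarrow> 'a \<Rightarrow> 'a tvec"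
  where "curvature_operator M \<A> D X Y Z p =
    D p (X p) (\<lambda>q. D q (Y q) Z) - D p (Y p) (\<lambda>q. D q (X q) Z) - D p (lie_bracket M \<A> X Y p) Z"

text \<open>
  By tensoriality the value of the curvature operator at \<open>p\<close> is the same for all local extensions
  \<open>X\<close>, \<open>Y\<close>, \<open>Z\<close> of the tangent vectors \<open>x\<close>, \<open>y\<close>, \<open>z\<close>, and such extensions exist.
\<close>

definition curvature_at ::
    "'a topology \<Rightarrow> ('a, 'e::euclidean_space) chart set \<Rightarrow>
      ('a \<Rightarrow> 'a tvec \<Rightarrow> ('a \<Rightarrow> 'a tvec) \<Rightarrow> 'a tvec) \<Rightarrow>
      'a \<Rightarrow> 'a tvec \<Rightarrow> 'a tvec \<Rightarrow> 'a tvec \<Rightarrow> 'a tvec"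
  where "curvature_at M \<A> D p x y z = (THE w. \<exists>U X Y Z.
    openin M U \<and> p \<in> U \<and>
    vector_field M \<A> U X \<and> vector_field M \<A> U Y \<and> vector_field M \<A> U Z \<and>
    X p = x \<and> Y p = y \<and> Z p = z \<and> w = curvature_operator M \<A> D X Y Z p)"

definition curvature_tensor ::
    "'a topology \<Rightarrow> ('a, 'e::euclidean_space) chart set \<Rightarrow>
      ('a \<Rightarrow> 'a tvec \<Rightarrow> 'a tvec \<Rightarrow> real) \<Rightarrow>
      ('a \<Rightarrow> 'a tvec \<Rightarrow> ('a \<Rightarrow> 'a tvec) \<Rightarrow> 'a tvec) \<Rightarrow>
      'a \<Rightarrow> 'a tvec \<Rightarrow> 'a tvec \<Rightarrow> 'a tvec \<Rightarrow> 'a tvec \<Rightarrow> real"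
  where "curvature_tensor M \<A> g D p x y z u = g p (curvature_at M \<A> D p x y z) u"

definition pointwise_constant_holomorphic_curvature ::
    "'a topology \<Rightarrow> ('a, 'e::euclidean_space) chart set \<Rightarrow>
      ('a \<Rightarrow> 'a tvec \<Rightarrow> 'a tvec \<Rightarrow> real) \<Rightarrow> ('a \<Rightarrow> 'a tvec \<Rightarrow> 'a tvec) \<Rightarrow>
      ('a \<Rightarrow> 'a tvec \<Rightarrow> ('a \<Rightarrow> 'a tvec) \<Rightarrow> 'a tvec) \<Rightarrow> bool"
  where "pointwise_constant_holomorphic_curvature M \<A> g J D \<longleftrightarrow>
    (\<forall>p\<in>topspace M. \<exists>k. \<forall>x\<in>tangent_space M \<A> p. g p x x = 1 \<longrightarrow>
       curvature_tensor M \<A> g D p x (J p x) (J p x) x = k)"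


section \<open>Complexification\<close>

text \<open>
  The complexification of a real vector space \<open>V\<close> is \<open>V \<times> V\<close>, where \<open>(x, y)\<close> stands for
  \<open>x + \<i> y\<close>.
\<close>

definition cscale :: "complex \<Rightarrow> 'v::real_vector \<times> 'v \<Rightarrow> 'v \<times> 'v"
  where "cscale c Z =
    (Re c *\<^sub>R fst Z - Im c *\<^sub>R snd Z, Im c *\<^sub>R fst Z + Re c *\<^sub>R snd Z)"

global_interpretation cplx: vector_space cscale
  by unfold_locales
    (auto simp: cscale_def algebra_simps)

text \<open>
  The complex linear extension of a real linear \<open>F\<close>; multilinear maps are extended one argument at
  a time.
\<close>

definition cext :: "('v \<Rightarrow> complex) \<Rightarrow> 'v \<times> 'v \<Rightarrow> complex"
  where "cext F Z = F (fst Z) + \<i> * F (snd Z)"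

definition cext2 :: "('v \<Rightarrow> 'v \<Rightarrow> real) \<Rightarrow> 'v \<times> 'v \<Rightarrow> 'v \<times> 'v \<Rightarrow> complex"
  where "cext2 b Z W = cext (\<lambda>z. cext (\<lambda>w. complex_of_real (b z w)) W) Z"

definition cext4 :: "('v \<Rightarrow> 'v \<Rightarrow> 'v \<Rightarrow> 'v \<Rightarrow> real) \<Rightarrow>
    'v \<times> 'v \<Rightarrow> 'v \<times> 'v \<Rightarrow> 'v \<times> 'v \<Rightarrow> 'v \<times> 'v \<Rightarrow> complex"
  where "cext4 r X Y Z W =
    cext (\<lambda>x. cext (\<lambda>y. cext (\<lambda>z. cext (\<lambda>w. complex_of_real (r x y z w)) W) Z) Y) X"

text \<open>
  In the following, \<open>T\<close> is a real vector space (a subspace of \<open>'v\<close>), \<open>b\<close> a symmetric bilinear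
  form, \<open>j\<close> an endomorphism and \<open>r\<close> a 4-linear form on \<open>T\<close>.
\<close>

definition complex_plane :: "'v::real_vector set \<Rightarrow> ('v \<times> 'v) set \<Rightarrow> bool"
  where "complex_plane T \<alpha> \<longleftrightarrow> \<alpha> \<subseteq> T \<times> T \<and> cplx.subspace \<alpha> \<and> cplx.dim \<alpha> = 2"

definition holomorphic_plane :: "('v \<Rightarrow> 'v) \<Rightarrow> ('v \<times> 'v) set \<Rightarrow> bool"
  where "holomorphic_plane j \<alpha> \<longleftrightarrow> \<alpha> = map_prod j j ` \<alpha>"

definition signature_pp :: "('v::real_vector \<Rightarrow> 'v \<Rightarrow> real) \<Rightarrow> ('v \<times> 'v) set \<Rightarrow> bool"
  where "signature_pp b \<alpha> \<longleftrightarrow>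
    (\<exists>X Y. \<alpha> = cplx.span {X, Y} \<and> cext2 b X X = 1 \<and> cext2 b Y Y = 1 \<and> cext2 b X Y = 0)"

text \<open>
  The sectional curvature of a nondegenerate plane; the quotient does not depend on the
  choice of the spanning vectors.  Planes of signature \<open>(+,+)\<close> are nondegenerate.
\<close>

definition csectional_curvature ::
    "('v::real_vector \<Rightarrow> 'v \<Rightarrow> real) \<Rightarrow> ('v \<Rightarrow> 'v \<Rightarrow> 'v \<Rightarrow> 'v \<Rightarrow> real) \<Rightarrow>
      ('v \<times> 'v) set \<Rightarrow> complex"
  where "csectional_curvature b r \<alpha> = (THE k. \<exists>X Y. \<alpha> = cplx.span {X, Y} \<and>
    k = cext4 r X Y Y X / (cext2 b X X * cext2 b Y Y - (cext2 b X Y)\<^sup>2))"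

end

theory Submission
  imports Defs
begin

text \<open>
  Let \<open>x\<close>, \<open>y\<close> be orthonormal tangent vectors at \<open>p\<close> and \<open>Z = cosh t x + \<i> sinh t y\<close>. Then
  \<open>g(Z, Z) = 1\<close> and \<open>Z\<close>, \<open>JZ\<close> span a holomorphic plane of signature \<open>(+,+)\<close>, whose curvature is a
  quartic form in \<open>cosh t\<close> and \<open>\<i> sinh t\<close> with extreme coefficients \<open>H(x)\<close> and \<open>H(y)\<close>. If its real
  part stays bounded as \<open>t \<rightarrow> \<infinity>\<close>, comparing the two leading powers of \<open>sinh t\<close> gives \<open>H(x) = H(y)\<close>.
  If its imaginary part stays bounded, the odd coefficients vanish, so \<open>H(a x + b y) = H(a x - b y)\<close>;
  applied to the orthonormal pair \<open>(x + y)/\<surd>2\<close>, \<open>(x - y)/\<surd>2\<close> this again gives \<open>H(x) = H(y)\<close>. In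
  dimension greater than 2 any two unit vectors have a common orthogonal unit vector.

  The curvature at a point makes sense because every derivation at a point is, by Hadamard's lemma,
  the value of a coordinate vector field, and the curvature operator is linear over smooth functions.
\<close>

section \<open>Smooth maps and Hadamard's lemma\<close>

text \<open>No relation between \<open>y\<close> and \<open>Jx\<close> is imposed:
  \<open>g(Z, JZ) = 0\<close> holds for every complex \<open>Z\<close>, because
  \<open>g(_, J _)\<close> is skew, so each point of the quadric \<open>g(Z, Z) = 1\<close> gives an
  admissible plane. Unlike the real unit sphere of a definite metric, this quadric is unbounded, and
  that gives a mere bound its force. In the variable \<open>u = sinh^2 t\<close> the real part is a
  polynomial of degree two, so its coefficients of \<open>u\<close> and \<open>u^2\<close> vanish.
  The imaginary part carries the factor \<open>cosh t sinh t\<close>, which is no polynomial in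
  \<open>u\<close> but dominates \<open>u\<close>. An imaginary bound constrains only the odd
  coefficients, which do not involve \<open>H(x)\<close> and \<open>H(y)\<close>; this is why the
  pair has to be rotated by 45 degrees. Both \<open>curvature_at\<close> and
  \<open>csectional_curvature\<close> are definite descriptions. Their values become accessible only
  after independence of the choices is proved: extending fields in one case, spanning vectors in the
  other.\<close>

lemma higher_differentiable_on_cong:
  assumes "open S" "\<And>x. x \<in> S \<Longrightarrow> f x = h x"
  shows "higher_differentiable_on S f k = higher_differentiable_on S h k"
  using assms(2)
proof (induction k arbitrary: f h)
  case 0
  then show ?case by (simp cong: continuous_on_cong)
next
  case (Suc k)
  \<comment> \<open>Derivatives are taken at \<open>x\<close> in the whole space, not within
    \<open>S\<close>; agreement on \<open>S\<close> determines them because \<open>S\<close> is an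
    open neighbourhood of \<open>x\<close>.\<close>
  have iff: "(f has_derivative d) (at x) \<longleftrightarrow> (h has_derivative d) (at x)" if "x \<in> S" for x d
    using has_derivative_transform_within_open[OF _ assms(1) that, of f d UNIV h]
      has_derivative_transform_within_open[OF _ assms(1) that, of h d UNIV f] Suc.prems by auto
  have *: "f differentiable at x \<longleftrightarrow> h differentiable at x" if "x \<in> S" for x
    unfolding differentiable_def iff[OF that] ..
  have "frechet_derivative f (at x) = frechet_derivative h (at x)" if "x \<in> S" for x
    unfolding frechet_derivative_def iff[OF that] ..
  then have "higher_differentiable_on S (\<lambda>x. frechet_derivative f (at x) v) k =
      higher_differentiable_on S (\<lambda>x. frechet_derivative h (at x) v) k" for v
    by (intro Suc.IH) simp
  with * show ?case by simp
qed

text \<open>Allows any formula for the derivative that is valid on \<open>S\<close> to stand in for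
  \<open>frechet_derivative\<close>, whose values off \<open>S\<close> are uncontrolled.\<close>

lemma higher_differentiable_on_SucI:
  assumes "open S" "\<And>x. x \<in> S \<Longrightarrow> (f has_derivative f' x) (at x)"
    and "\<And>v. higher_differentiable_on S (\<lambda>x. f' x v) k"
  shows "higher_differentiable_on S f (Suc k)"
proof -
  have "frechet_derivative f (at x) = f' x" if "x \<in> S" for x
    using assms(2)[OF that] frechet_derivative_at by metis
  then have "higher_differentiable_on S (\<lambda>x. frechet_derivative f (at x) v) k" for v
    using assms(3)[of v] by (subst higher_differentiable_on_cong[OF assms(1)]) auto
  moreover have "f differentiable at x" if "x \<in> S" for x
    using assms(2)[OF that] differentiable_def by blast
  ultimately show ?thesis by simp
qed

lemma higher_differentiable_on_SucD:
  assumes "higher_differentiable_on S f (Suc k)" "x \<in> S"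
  shows "(f has_derivative frechet_derivative f (at x)) (at x)"
  using assms frechet_derivative_works by auto

lemma higher_differentiable_on_subset:
  "higher_differentiable_on S f k \<Longrightarrow> S' \<subseteq> S \<Longrightarrow> higher_differentiable_on S' f k"
  by (induction k arbitrary: f) (auto intro: continuous_on_subset)

text \<open>Needed for the product and chain rules, where undifferentiated factors survive next to
  differentiated ones and both must have the same order.\<close>

lemma higher_differentiable_on_pred:
  assumes "open S" "higher_differentiable_on S f (Suc k)"
  shows "higher_differentiable_on S f k"
  using assms(2)
proof (induction k arbitrary: f)
  case 0
  then show ?case
    by (auto intro!: continuous_at_imp_continuous_on differentiable_imp_continuous_within)
next
  case (Suc k)
  from Suc.prems have 1: "\<forall>x\<in>S. f differentiable at x"
    and 2: "\<And>v. higher_differentiable_on S (\<lambda>x. frechet_derivative f (at x) v) (Suc k)"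
    by (auto simp only: higher_differentiable_on.simps)
  from 2 have "\<And>v. higher_differentiable_on S (\<lambda>x. frechet_derivative f (at x) v) k"
    by (rule Suc.IH)
  with 1 show ?case by simp
qed

lemma higher_differentiable_on_const [simp]:
  "open S \<Longrightarrow> higher_differentiable_on S (\<lambda>x. c) k"
proof (induction k arbitrary: c)
  case (Suc k)
  then show ?case
    by (intro higher_differentiable_on_SucI[where f' = "\<lambda>x v. 0"]) auto
qed simp

lemma higher_differentiable_on_add:
  assumes "open S" "higher_differentiable_on S f k" "higher_differentiable_on S h k"
  shows "higher_differentiable_on S (\<lambda>x. f x + h x) k"
  using assms(2,3)
proof (induction k arbitrary: f h)
  case (Suc k)
  show ?case
  proof (rule higher_differentiable_on_SucI[OF assms(1)])
    show "((\<lambda>x. f x + h x) has_derivative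
        (\<lambda>v. frechet_derivative f (at x) v + frechet_derivative h (at x) v)) (at x)" if "x \<in> S" for x
      using Suc.prems that by (intro has_derivative_add higher_differentiable_on_SucD)
    show "higher_differentiable_on S
        (\<lambda>x. frechet_derivative f (at x) v + frechet_derivative h (at x) v) k" for v
      using Suc by auto
  qed
qed (auto intro: continuous_intros)

lemma higher_differentiable_on_sum:
  assumes "open S" "\<And>i. i \<in> I \<Longrightarrow> higher_differentiable_on S (f i) k"
  shows "higher_differentiable_on S (\<lambda>x. \<Sum>i\<in>I. f i x) k"
  using assms(2)
  by (induction I rule: infinite_finite_induct)
     (auto intro: higher_differentiable_on_add simp: assms(1))

lemma higher_differentiable_on_bounded_linear:
  assumes "open S" "bounded_linear L" "higher_differentiable_on S f k"
  shows "higher_differentiable_on S (\<lambda>x. L (f x)) k"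
  using assms(3)
proof (induction k arbitrary: f)
  case 0
  then show ?case using assms(2) by (auto intro: bounded_linear.continuous_on)
next
  case (Suc k)
  show ?case
  proof (rule higher_differentiable_on_SucI[OF assms(1)])
    show "((\<lambda>x. L (f x)) has_derivative (\<lambda>v. L (frechet_derivative f (at x) v))) (at x)"
      if "x \<in> S" for x
      by (rule bounded_linear.has_derivative[OF assms(2) higher_differentiable_on_SucD[OF Suc.prems that]])
    show "higher_differentiable_on S (\<lambda>x. L (frechet_derivative f (at x) v)) k" for v
      using Suc by auto
  qed
qed

lemma higher_differentiable_on_ident:
  assumes "open S"
  shows "higher_differentiable_on S (\<lambda>x. x) k"
proof (cases k)
  case (Suc k')
  then show ?thesis
    using higher_differentiable_on_SucI[OF assms, of "\<lambda>x. x" "\<lambda>x v. v" k'] assms by simp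
qed simp

lemma (in bounded_bilinear) higher_differentiable_on:
  assumes "open S" "higher_differentiable_on S f k" "higher_differentiable_on S h k"
  shows "higher_differentiable_on S (\<lambda>x. prod (f x) (h x)) k"
  using assms(2,3)
proof (induction k arbitrary: f h)
  case 0
  then show ?case by (auto intro: continuous_on)
next
  case (Suc k)
  show ?case
  proof (rule higher_differentiable_on_SucI[OF assms(1)])
    show "((\<lambda>x. prod (f x) (h x)) has_derivative
        (\<lambda>v. prod (f x) (frechet_derivative h (at x) v) + prod (frechet_derivative f (at x) v) (h x)))
        (at x)" if "x \<in> S" for x
      by (rule FDERIV[OF Suc.prems[THEN higher_differentiable_on_SucD, OF that]])
    show "higher_differentiable_on S
        (\<lambda>x. prod (f x) (frechet_derivative h (at x) v) + prod (frechet_derivative f (at x) v) (h x)) k"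
      for v
      using Suc.prems by (intro higher_differentiable_on_add assms(1) Suc.IH
          higher_differentiable_on_pred[OF assms(1) Suc.prems(1)]
          higher_differentiable_on_pred[OF assms(1) Suc.prems(2)]) auto
  qed
qed

lemma higher_differentiable_on_compose:
  fixes f :: "'e::euclidean_space \<Rightarrow> real" and h :: "'v::real_normed_vector \<Rightarrow> 'e"
  assumes "open S" "open T" "h ` S \<subseteq> T"
    and "higher_differentiable_on T f k" "higher_differentiable_on S h k"
  shows "higher_differentiable_on S (\<lambda>x. f (h x)) k"
  using assms(4,5)
proof (induction k arbitrary: f)
  case 0
  then show ?case
    using assms(3) by (auto intro: continuous_on_compose2)
next
  case (Suc k)
  \<comment> \<open>In the plain chain rule both the base point and the direction of the derivative
    of \<open>f\<close> vary with \<open>x\<close>. Expanding the direction in the basis leaves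
    fixed directions \<open>b\<close>, so that the induction hypothesis applies to each partial
    derivative of \<open>f\<close>.\<close>
  let ?f' = "\<lambda>x v. \<Sum>b\<in>Basis. (frechet_derivative h (at x) v \<bullet> b) * frechet_derivative f (at (h x)) b"
  show ?case
  proof (rule higher_differentiable_on_SucI[OF assms(1)])
    fix x assume x: "x \<in> S"
    then have hx: "h x \<in> T" using assms(3) by auto
    have 1: "((\<lambda>x. f (h x)) has_derivative
        (\<lambda>v. frechet_derivative f (at (h x)) (frechet_derivative h (at x) v))) (at x)"
      using diff_chain_at[OF higher_differentiable_on_SucD[OF Suc.prems(2) x]
        higher_differentiable_on_SucD[OF Suc.prems(1) hx]] by (simp add: o_def)
    have lin: "linear (frechet_derivative f (at (h x)))"
      using Suc.prems(1) hx by (intro linear_frechet_derivative) auto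
    have repr: "frechet_derivative f (at (h x)) w = (\<Sum>b\<in>Basis. (w \<bullet> b) * frechet_derivative f (at (h x)) b)" for w
      using linear_sum[OF lin, of "\<lambda>b. (w \<bullet> b) *\<^sub>R b" Basis] linear_scale[OF lin]
      by (simp add: euclidean_representation)
    show "((\<lambda>x. f (h x)) has_derivative ?f' x) (at x)"
      using 1 unfolding repr[of "frechet_derivative h (at x) _"] .
  next
    fix v
    have h': "higher_differentiable_on S h k"
      using higher_differentiable_on_pred assms(1) Suc.prems(2) by blast
    show "higher_differentiable_on S (\<lambda>x. ?f' x v) k"
    proof (rule higher_differentiable_on_sum[OF assms(1)],
        rule bounded_bilinear.higher_differentiable_on[OF bounded_bilinear_mult assms(1)])
      fix b :: 'e
      show "higher_differentiable_on S (\<lambda>x. frechet_derivative h (at x) v \<bullet> b) k"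
        using Suc.prems(2)
        by (intro higher_differentiable_on_bounded_linear[OF assms(1) bounded_linear_inner_left]) simp
      show "higher_differentiable_on S (\<lambda>x. frechet_derivative f (at (h x)) b) k"
        using Suc.prems(1) by (intro Suc.IH h') simp
    qed
  qed
qed

section \<open>Smooth maps between normed spaces\<close>

lemma smooth_on_cong:
  "open S \<Longrightarrow> (\<And>x. x \<in> S \<Longrightarrow> f x = h x) \<Longrightarrow> smooth_on S f = smooth_on S h"
  unfolding smooth_on_def using higher_differentiable_on_cong by metis

lemma smooth_on_subset: "smooth_on S f \<Longrightarrow> S' \<subseteq> S \<Longrightarrow> smooth_on S' f"
  unfolding smooth_on_def using higher_differentiable_on_subset by metis

lemma smooth_on_const: "open S \<Longrightarrow> smooth_on S (\<lambda>x. c)"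
  unfolding smooth_on_def by (intro allI higher_differentiable_on_const)

lemma smooth_on_ident: "open S \<Longrightarrow> smooth_on S (\<lambda>x. x)"
  unfolding smooth_on_def by (intro allI higher_differentiable_on_ident)

lemma smooth_on_add:
  "open S \<Longrightarrow> smooth_on S f \<Longrightarrow> smooth_on S h \<Longrightarrow> smooth_on S (\<lambda>x. f x + h x)"
  unfolding smooth_on_def by (intro allI higher_differentiable_on_add) auto

lemma smooth_on_mult:
  fixes f h :: "'v::real_normed_vector \<Rightarrow> real"
  shows "open S \<Longrightarrow> smooth_on S f \<Longrightarrow> smooth_on S h \<Longrightarrow> smooth_on S (\<lambda>x. f x * h x)"
  unfolding smooth_on_def
  by (intro allI bounded_bilinear.higher_differentiable_on[OF bounded_bilinear_mult]) auto

lemma smooth_on_bounded_linear: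
  "open S \<Longrightarrow> bounded_linear L \<Longrightarrow> smooth_on S f \<Longrightarrow> smooth_on S (\<lambda>x. L (f x))"
  unfolding smooth_on_def by (rule allI, rule higher_differentiable_on_bounded_linear) auto

lemma smooth_on_compose:
  fixes f :: "'e::euclidean_space \<Rightarrow> real" and h :: "'v::real_normed_vector \<Rightarrow> 'e"
  assumes "open S" "open T" "h ` S \<subseteq> T" "smooth_on T f" "smooth_on S h"
  shows "smooth_on S (\<lambda>x. f (h x))"
  using assms(4,5) unfolding smooth_on_def
  by (auto intro!: higher_differentiable_on_compose[OF assms(1-3)])

lemma smooth_on_frechet_derivative:
  "smooth_on S f \<Longrightarrow> smooth_on S (\<lambda>x. frechet_derivative f (at x) v)"
  unfolding smooth_on_def by (metis higher_differentiable_on.simps(2))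

lemma smooth_on_has_derivative:
  "smooth_on S f \<Longrightarrow> x \<in> S \<Longrightarrow> (f has_derivative frechet_derivative f (at x)) (at x)"
  unfolding smooth_on_def using higher_differentiable_on_SucD by blast

lemma smooth_on_imp_continuous_on: "smooth_on S f \<Longrightarrow> continuous_on S f"
  unfolding smooth_on_def by (metis higher_differentiable_on.simps(1))

section \<open>Integrals along segments from the centre of a ball\<close>

context
  fixes x0 :: "'e::euclidean_space" and r :: real
begin

lemma dist_segment_less:
  assumes "dist x0 x < r" "0 \<le> t" "t \<le> 1"
  shows "dist x0 (x0 + t *\<^sub>R (x - x0)) < r"
proof -
  have "dist x0 (x0 + t *\<^sub>R (x - x0)) = t * dist x0 x"
    using assms(2) by (simp add: dist_norm norm_minus_commute)
  also have "\<dots> \<le> 1 * dist x0 x" using assms by (intro mult_right_mono) auto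
  finally show ?thesis using assms(1) by simp
qed

lemma segment_in_ball:
  "x \<in> ball x0 r \<Longrightarrow> t \<in> {0..1} \<Longrightarrow> x0 + t *\<^sub>R (x - x0) \<in> ball x0 r"
  by (auto intro: dist_segment_less)

lemma continuous_on_segment:
  fixes F :: "'e \<Rightarrow> real"
  assumes "continuous_on (ball x0 r) F"
  shows "continuous_on (ball x0 r \<times> {0..1}) (\<lambda>(x, t). F (x0 + t *\<^sub>R (x - x0)))"
  using assms by (auto simp: case_prod_beta intro!: continuous_intros continuous_on_compose2[OF assms]
      dest: dist_segment_less)

text \<open>Differentiation under the integral sign. The chain rule along
  \<open>x0 + t (x - x0)\<close> contributes a factor \<open>t\<close>, which raises the exponent of
  the weight by one.\<close>

lemma has_derivative_segment_integral:
  fixes F :: "'e \<Rightarrow> real"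
  assumes F: "smooth_on (ball x0 r) F" and x: "x \<in> ball x0 r"
  shows "((\<lambda>x. integral {0..1} (\<lambda>t. t ^ n * F (x0 + t *\<^sub>R (x - x0)))) has_derivative
    (\<lambda>v. integral {0..1} (\<lambda>t. t ^ Suc n * frechet_derivative F (at (x0 + t *\<^sub>R (x - x0))) v))) (at x)"
proof -
  let ?s = "\<lambda>x t. x0 + t *\<^sub>R (x - x0)"
  \<comment> \<open>The Leibniz rule asks for the derivative as a jointly continuous family of
    bounded linear maps; in finite dimension its continuity can be checked on each basis
    vector.\<close>
  define fx where "fx x t = t ^ Suc n *\<^sub>R Blinfun (frechet_derivative F (at (?s x t)))" for x t
  have der: "(F has_derivative frechet_derivative F (at (?s x t))) (at (?s x t))"
    if "x \<in> ball x0 r" "t \<in> {0..1}" for x t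
    using smooth_on_has_derivative[OF F segment_in_ball[OF that]] .
  have fx: "blinfun_apply (fx x t) v = t ^ Suc n * frechet_derivative F (at (?s x t)) v"
    if "x \<in> ball x0 r" "t \<in> {0..1}" for x t v
    using has_derivative_bounded_linear[OF der[OF that]]
    by (simp add: fx_def blinfun.scaleR_left bounded_linear_Blinfun_apply)
  have cont: "continuous_on {0..1} (\<lambda>t. G (?s x t))"
    if "continuous_on (ball x0 r) G" "x \<in> ball x0 r" for G :: "'e \<Rightarrow> real" and x
    using that by (auto intro!: continuous_intros continuous_on_compose2[OF that(1)] dest: dist_segment_less)
  have contfx: "continuous_on (ball x0 r \<times> {0..1}) (\<lambda>(x, t). fx x t)"
  proof (rule continuous_on_blinfun_componentwise)
    fix i :: 'e
    have "continuous_on (ball x0 r \<times> {0..1}) (\<lambda>(x, t). t ^ Suc n * (\<lambda>(x, t). frechet_derivative F (at (?s x t)) i) (x, t))"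
      unfolding case_prod_beta prod.collapse
      by (intro continuous_intros continuous_on_segment[unfolded case_prod_beta]
          smooth_on_imp_continuous_on smooth_on_frechet_derivative F)
    then show "continuous_on (ball x0 r \<times> {0..1}) (\<lambda>y. blinfun_apply ((\<lambda>(x, t). fx x t) y) i)"
      by (rule continuous_on_eq) (auto simp: fx)
  qed
  have "((\<lambda>x. integral (cbox 0 1) (\<lambda>t. t ^ n * F (?s x t))) has_derivative
      blinfun_apply (integral (cbox 0 1) (fx x))) (at x within ball x0 r)"
  proof (rule leibniz_rule[where fx = fx])
    fix x t assume xt: "x \<in> ball x0 r" "t \<in> cbox 0 (1::real)"
    then have xt': "x \<in> ball x0 r" "t \<in> {0..1}" by auto
    have "((\<lambda>x. ?s x t) has_derivative (\<lambda>v. t *\<^sub>R v)) (at x)"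
      by (auto intro!: derivative_eq_intros)
    from has_derivative_compose[where g = F, OF this der[OF xt']]
    have "((\<lambda>x. t ^ n * F (?s x t)) has_derivative
        (\<lambda>v. t ^ n * frechet_derivative F (at (?s x t)) (t *\<^sub>R v))) (at x)"
      by (rule has_derivative_mult_right)
    note der_n = this
    have "frechet_derivative F (at (?s x t)) (t *\<^sub>R v) = t * frechet_derivative F (at (?s x t)) v" for v
      using linear_scale[OF has_derivative_linear[OF der[OF xt']]] by simp
    then have "blinfun_apply (fx x t) = (\<lambda>v. t ^ n * frechet_derivative F (at (?s x t)) (t *\<^sub>R v))"
      by (intro ext) (simp add: fx[OF xt'])
    with der_n show "((\<lambda>x. t ^ n * F (?s x t)) has_derivative blinfun_apply (fx x t)) (at x within ball x0 r)"
      by (simp only: has_derivative_at_withinI)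
  next
    fix x assume "x \<in> ball x0 r"
    then show "(\<lambda>t. t ^ n * F (?s x t)) integrable_on cbox 0 1"
      unfolding cbox_interval
      by (intro integrable_continuous_interval continuous_intros cont smooth_on_imp_continuous_on F)
  qed (use contfx x in auto)
  moreover have "blinfun_apply (integral (cbox 0 1) (fx x)) v =
      integral {0..1} (\<lambda>t. t ^ Suc n * frechet_derivative F (at (?s x t)) v)" for v
  proof -
    have "continuous_on {0..1} (fx x)"
      using continuous_on_compose2[OF contfx, of "{0..1}" "\<lambda>t. (x, t)"] x
      by (simp add: continuous_on_Pair image_subset_iff)
    then have "blinfun_apply (integral (cbox 0 1) (fx x)) v = integral {0..1} (\<lambda>t. blinfun_apply (fx x t) v)"
      by (subst blinfun_apply_integral) (auto intro: integrable_continuous_interval)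
    also have "\<dots> = integral {0..1} (\<lambda>t. t ^ Suc n * frechet_derivative F (at (?s x t)) v)"
      by (rule integral_cong) (simp only: fx[OF x])
    finally show ?thesis .
  qed
  ultimately show ?thesis
    unfolding cbox_interval at_within_open[OF x open_ball] by (metis (no_types, lifting) ext)
qed

text \<open>The weight \<open>t ^ n\<close> makes the class of these integrals closed under differentiation.\<close>

lemma smooth_on_segment_integral:
  fixes F :: "'e \<Rightarrow> real"
  assumes "smooth_on (ball x0 r) F"
  shows "smooth_on (ball x0 r) (\<lambda>x. integral {0..1} (\<lambda>t. t ^ n * F (x0 + t *\<^sub>R (x - x0))))"
proof -
  have "higher_differentiable_on (ball x0 r)
      (\<lambda>x. integral {0..1} (\<lambda>t. t ^ n * F (x0 + t *\<^sub>R (x - x0)))) k" for k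
    using assms
  proof (induction k arbitrary: n F)
    case 0
    then show ?case
      using has_derivative_segment_integral[OF 0]
      by (auto intro!: continuous_at_imp_continuous_on has_derivative_continuous)
  next
    case (Suc k)
    show ?case
      by (rule higher_differentiable_on_SucI[OF open_ball has_derivative_segment_integral[OF Suc.prems]])
         (auto intro!: Suc.IH smooth_on_frechet_derivative Suc.prems simp del: power_Suc)
  qed
  then show ?thesis by (simp add: smooth_on_def)
qed

text \<open>The fundamental theorem of calculus on the segment from \<open>x0\<close> to
  \<open>x\<close>, with the derivative in direction \<open>x - x0\<close> expanded in the basis.
  \<open>G b\<close> is the average of a partial derivative over the segment; at
  \<open>x = x0\<close> the integrand is constant.\<close>

lemma hadamard_lemma:
  fixes F :: "'e \<Rightarrow> real"
  assumes F: "smooth_on (ball x0 r) F"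
  obtains G where "\<And>b. smooth_on (ball x0 r) (G b)"
    and "\<And>x. x \<in> ball x0 r \<Longrightarrow> F x = F x0 + (\<Sum>b\<in>Basis. ((x - x0) \<bullet> b) * G b x)"
    and "\<And>b. G b x0 = frechet_derivative F (at x0) b"
proof
  define G where "G b x = integral {0..1} (\<lambda>t. frechet_derivative F (at (x0 + t *\<^sub>R (x - x0))) b)" for b x
  show "smooth_on (ball x0 r) (G b)" for b
    using smooth_on_segment_integral[OF smooth_on_frechet_derivative[OF F, of b], of 0]
    by (simp add: G_def[abs_def])
  show "G b x0 = frechet_derivative F (at x0) b" for b
    by (simp add: G_def)
  fix x assume x: "x \<in> ball x0 r"
  let ?s = "\<lambda>t. x0 + t *\<^sub>R (x - x0)"
  have der: "(F has_derivative frechet_derivative F (at (?s t))) (at (?s t))" if "t \<in> {0..1}" for t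
    using smooth_on_has_derivative[OF F segment_in_ball[OF x that]] .
  have "((\<lambda>t. frechet_derivative F (at (?s t)) (x - x0)) has_integral F (?s 1) - F (?s 0)) {0..1}"
  proof (rule fundamental_theorem_of_calculus)
    fix t :: real assume t: "t \<in> {0..1}"
    have "(?s has_derivative (\<lambda>h. h *\<^sub>R (x - x0))) (at t within {0..1})"
      by (auto intro!: derivative_eq_intros)
    from has_derivative_compose[where g = F, OF this der[OF t]]
    have "((\<lambda>t. F (?s t)) has_derivative (\<lambda>h. frechet_derivative F (at (?s t)) (h *\<^sub>R (x - x0)))) (at t within {0..1})" .
    then show "((\<lambda>t. F (?s t)) has_vector_derivative frechet_derivative F (at (?s t)) (x - x0)) (at t within {0..1})"
      unfolding has_vector_derivative_def
      by (simp add: linear_scale[OF has_derivative_linear[OF der[OF t]]])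
  qed simp
  then have "F x - F x0 = integral {0..1} (\<lambda>t. frechet_derivative F (at (?s t)) (x - x0))"
    by (simp add: integral_unique)
  also have "\<dots> = integral {0..1} (\<lambda>t. \<Sum>b\<in>Basis. ((x - x0) \<bullet> b) * frechet_derivative F (at (?s t)) b)"
  proof (rule integral_cong)
    fix t :: real assume t: "t \<in> {0..1}"
    show "frechet_derivative F (at (?s t)) (x - x0) =
        (\<Sum>b\<in>Basis. ((x - x0) \<bullet> b) * frechet_derivative F (at (?s t)) b)"
      using linear_sum[OF has_derivative_linear[OF der[OF t]], of "\<lambda>b. ((x - x0) \<bullet> b) *\<^sub>R b" Basis]
        linear_scale[OF has_derivative_linear[OF der[OF t]]]
      by (simp add: euclidean_representation)
  qed
  also have "\<dots> = (\<Sum>b\<in>Basis. integral {0..1} (\<lambda>t. ((x - x0) \<bullet> b) * frechet_derivative F (at (?s t)) b))"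
  proof (rule integral_sum)
    fix b :: 'e
    have "continuous_on {0..1} (\<lambda>t. frechet_derivative F (at (?s t)) b)"
      using x by (intro continuous_on_compose2[OF
          smooth_on_imp_continuous_on[OF smooth_on_frechet_derivative[OF F]]])
        (auto intro!: continuous_intros dest: dist_segment_less)
    then show "(\<lambda>t. ((x - x0) \<bullet> b) * frechet_derivative F (at (?s t)) b) integrable_on {0..1}"
      by (intro integrable_continuous_interval continuous_intros)
  qed simp
  finally show "F x = F x0 + (\<Sum>b\<in>Basis. ((x - x0) \<bullet> b) * G b x)"
    by (simp add: G_def)
qed

end

section \<open>Holomorphic curvature of complexified planes\<close>

text \<open>The second difference \<open>P(2u) - 2 P(u) + P(0)\<close> of a quadratic polynomial
  isolates its leading term, so a bound on \<open>P\<close> bounds \<open>d * u^2\<close>. Once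
  \<open>d = 0\<close>, the difference \<open>P(u) - P(0)\<close> treats the linear term in the same
  way.\<close>

lemma bounded_quadratic_coeffs_zero:
  fixes a b d c :: real
  assumes "\<And>u. u \<ge> 0 \<Longrightarrow> \<bar>a + b * u + d * u\<^sup>2\<bar> \<le> c"
  shows "b = 0 \<and> d = 0"
proof -
  have lin: "k = 0" if "\<And>u. u \<ge> 1 \<Longrightarrow> \<bar>k\<bar> * u \<le> e" for k e :: real
  proof (rule ccontr)
    assume "k \<noteq> 0"
    \<comment> \<open>This choice of \<open>u\<close> is at least 1 and makes the left side exceed
      the bound by \<open>\<bar>k\<bar>\<close>.\<close>
    have "\<bar>k\<bar> * (1 + \<bar>e\<bar> / \<bar>k\<bar>) \<le> e" by (rule that) simp
    moreover have "\<bar>k\<bar> * (1 + \<bar>e\<bar> / \<bar>k\<bar>) = \<bar>k\<bar> + \<bar>e\<bar>"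
      using \<open>k \<noteq> 0\<close> by (simp add: field_simps)
    ultimately have "\<bar>k\<bar> + \<bar>e\<bar> \<le> e" by simp
    then show False using \<open>k \<noteq> 0\<close> by linarith
  qed
  have "d = 0"
  proof (rule lin)
    fix u :: real assume u: "u \<ge> 1"
    have "2 * d * u\<^sup>2 = (a + b * (2 * u) + d * (2 * u)\<^sup>2) - 2 * (a + b * u + d * u\<^sup>2) + a"
      by (simp add: algebra_simps power2_eq_square)
    also have "\<bar>\<dots>\<bar> \<le> c + 2 * c + c"
      using assms[of "2 * u"] assms[of u] assms[of 0] u by auto
    finally have "2 * (\<bar>d\<bar> * u\<^sup>2) \<le> 4 * c" by (simp add: abs_mult)
    moreover have "\<bar>d\<bar> * u \<le> \<bar>d\<bar> * u\<^sup>2"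
      using u by (intro mult_left_mono) (auto simp: power2_eq_square)
    ultimately show "\<bar>d\<bar> * u \<le> 2 * c" by linarith
  qed
  moreover have "b = 0"
  proof (rule lin)
    fix u :: real assume u: "u \<ge> 1"
    have "\<bar>b * u\<bar> \<le> 2 * c"
      using assms[of u] assms[of 0] u \<open>d = 0\<close> by auto
    then show "\<bar>b\<bar> * u \<le> 2 * c" using u by (simp add: abs_mult)
  qed
  ultimately show ?thesis by simp
qed

text \<open>Real linearity of \<open>F\<close> is known only on the subspace \<open>T\<close>, hence
  the relative formulation. It is applied to one argument of a multilinear extension at a time, the
  others being frozen inside \<open>F\<close>.\<close>

lemma cext_cscale_add:
  assumes F: "\<And>u v a b. u \<in> T \<Longrightarrow> v \<in> T \<Longrightarrow>
      F (a *\<^sub>R u + b *\<^sub>R v) = complex_of_real a * F u + complex_of_real b * F v"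
    and T: "\<And>u v a b. u \<in> T \<Longrightarrow> v \<in> T \<Longrightarrow> a *\<^sub>R u + b *\<^sub>R v \<in> T"
    and Z: "Z \<in> T \<times> T" and W: "W \<in> T \<times> T"
  shows "cext F (cscale a Z + cscale b W) = a * cext F Z + b * cext F W"
proof -
  obtain z1 z2 w1 w2 where Z': "Z = (z1, z2)" and W': "W = (w1, w2)" by fastforce
  with Z W have mem: "z1 \<in> T" "z2 \<in> T" "w1 \<in> T" "w2 \<in> T" by auto
  have 1: "F (p *\<^sub>R z1 + q *\<^sub>R z2 + (s *\<^sub>R w1 + t *\<^sub>R w2)) =
      p * F z1 + q * F z2 + (s * F w1 + t * F w2)" for p q s t :: real
    using F[OF T[OF mem(1,2)] T[OF mem(3,4)], of 1 p q 1 s t] F[OF mem(1,2)] F[OF mem(3,4)] by simp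
  have "cext F (cscale a Z + cscale b W) =
      F (Re a *\<^sub>R z1 + (- Im a) *\<^sub>R z2 + (Re b *\<^sub>R w1 + (- Im b) *\<^sub>R w2)) +
      \<i> * F (Im a *\<^sub>R z1 + Re a *\<^sub>R z2 + (Im b *\<^sub>R w1 + Re b *\<^sub>R w2))"
    by (simp add: cext_def cscale_def Z' W')
  also have "\<dots> = a * cext F Z + b * cext F W"
    unfolding 1 by (simp add: complex_eq_iff cext_def Z' W' algebra_simps)
  finally show ?thesis .
qed

lemma cplx_span_pair: "cplx.span {X, Y} = {cscale a X + cscale b Y |a b. True}"
  unfolding cplx.span_insert cplx.span_singleton image_def by (auto simp: diff_eq_eq add.commute)

lemma cplx_span_pairE:
  assumes "V \<in> cplx.span {X, Y}"
  obtains a b where "V = cscale a X + cscale b Y"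
  using assms unfolding cplx_span_pair by auto

text \<open>The linear algebra at a single point, with \<open>T\<close> in the role of the tangent
  space. Linearity of \<open>r\<close> is demanded in the first and third slots; the two skew
  symmetries carry it over to the second and fourth.\<close>

locale hermitian_curvature_space =
  fixes T :: "'v::real_vector set" and b :: "'v \<Rightarrow> 'v \<Rightarrow> real" and j :: "'v \<Rightarrow> 'v"
    and r :: "'v \<Rightarrow> 'v \<Rightarrow> 'v \<Rightarrow> 'v \<Rightarrow> real"
  assumes T: "u \<in> T \<Longrightarrow> v \<in> T \<Longrightarrow> a *\<^sub>R u + c *\<^sub>R v \<in> T"
    and b_comm: "u \<in> T \<Longrightarrow> v \<in> T \<Longrightarrow> b u v = b v u"
    and b_lin: "u \<in> T \<Longrightarrow> v \<in> T \<Longrightarrow> w \<in> T \<Longrightarrow> b w (a *\<^sub>R u + c *\<^sub>R v) = a * b w u + c * b w v"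
    and b_pos: "u \<in> T \<Longrightarrow> u \<noteq> 0 \<Longrightarrow> b u u > 0"
    and j_mem: "u \<in> T \<Longrightarrow> j u \<in> T"
    and j_lin: "u \<in> T \<Longrightarrow> v \<in> T \<Longrightarrow> j (a *\<^sub>R u + c *\<^sub>R v) = a *\<^sub>R j u + c *\<^sub>R j v"
    and j_j: "u \<in> T \<Longrightarrow> j (j u) = - u"
    and b_j: "u \<in> T \<Longrightarrow> v \<in> T \<Longrightarrow> b (j u) (j v) = b u v"
    and r_lin1: "u \<in> T \<Longrightarrow> v \<in> T \<Longrightarrow> x \<in> T \<Longrightarrow> y \<in> T \<Longrightarrow> z \<in> T \<Longrightarrow>
      r (a *\<^sub>R u + c *\<^sub>R v) x y z = a * r u x y z + c * r v x y z"
    and r_lin3: "u \<in> T \<Longrightarrow> v \<in> T \<Longrightarrow> x \<in> T \<Longrightarrow> y \<in> T \<Longrightarrow> z \<in> T \<Longrightarrow>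
      r x y (a *\<^sub>R u + c *\<^sub>R v) z = a * r x y u z + c * r x y v z"
    and r_skew12: "x \<in> T \<Longrightarrow> y \<in> T \<Longrightarrow> z \<in> T \<Longrightarrow> w \<in> T \<Longrightarrow> r x y z w = - r y x z w"
    and r_skew34: "x \<in> T \<Longrightarrow> y \<in> T \<Longrightarrow> z \<in> T \<Longrightarrow> w \<in> T \<Longrightarrow> r x y z w = - r x y w z"
begin

lemma scale_mem: "u \<in> T \<Longrightarrow> a *\<^sub>R u \<in> T"
  using T[of u u a 0] by simp

lemma add_mem: "u \<in> T \<Longrightarrow> v \<in> T \<Longrightarrow> u + v \<in> T"
  using T[of u v 1 1] by simp

lemma diff_mem: "u \<in> T \<Longrightarrow> v \<in> T \<Longrightarrow> u - v \<in> T"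
  using T[of u v 1 "-1"] by simp

lemma b_lin_left: "u \<in> T \<Longrightarrow> v \<in> T \<Longrightarrow> w \<in> T \<Longrightarrow> b (a *\<^sub>R u + c *\<^sub>R v) w = a * b u w + c * b v w"
  using b_lin[of u v w a c] b_comm T by simp

lemma r_lin2:
  assumes "u \<in> T" "v \<in> T" "x \<in> T" "y \<in> T" "z \<in> T"
  shows "r x (a *\<^sub>R u + c *\<^sub>R v) y z = a * r x u y z + c * r x v y z"
  using r_lin1[of u v x y z a c] assms T
    r_skew12[of x "a *\<^sub>R u + c *\<^sub>R v" y z] r_skew12[of x u y z] r_skew12[of x v y z] by simp

lemma r_lin4:
  assumes "u \<in> T" "v \<in> T" "x \<in> T" "y \<in> T" "z \<in> T"
  shows "r x y z (a *\<^sub>R u + c *\<^sub>R v) = a * r x y z u + c * r x y z v"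
  using r_lin3[of u v x y z a c] assms T
    r_skew34[of x y z "a *\<^sub>R u + c *\<^sub>R v"] r_skew34[of x y z u] r_skew34[of x y z v] by simp

lemma b_scale:
  assumes "u \<in> T" "v \<in> T"
  shows "b (a *\<^sub>R u) v = a * b u v" "b u (a *\<^sub>R v) = a * b u v"
  using b_lin[of v v u a 0] b_lin_left[of u u v a 0] assms by auto

lemma j_scale: "u \<in> T \<Longrightarrow> j (a *\<^sub>R u) = a *\<^sub>R j u"
  using j_lin[of u u a 0] by simp

lemma r_scale:
  assumes "x \<in> T" "y \<in> T" "z \<in> T" "w \<in> T"
  shows "r (a *\<^sub>R x) y z w = a * r x y z w" "r x (a *\<^sub>R y) z w = a * r x y z w"
    "r x y (a *\<^sub>R z) w = a * r x y z w" "r x y z (a *\<^sub>R w) = a * r x y z w"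
  using r_lin1[of x x y z w a 0] r_lin2[of y y x z w a 0] r_lin3[of z z x y w a 0]
    r_lin4[of w w x y z a 0] assms by auto

section \<open>Complex multilinear extensions of the metric and the curvature\<close>

lemma cscale_mem:
  assumes "Z \<in> T \<times> T" "W \<in> T \<times> T"
  shows "cscale a Z + cscale c W \<in> T \<times> T"
  using assms by (auto simp: cscale_def mem_Times_iff intro!: add_mem diff_mem scale_mem)

lemma cext2_lin1:
  assumes "Z \<in> T \<times> T" "W \<in> T \<times> T" "U \<in> T \<times> T"
  shows "cext2 b (cscale a Z + cscale c W) U = a * cext2 b Z U + c * cext2 b W U"
  unfolding cext2_def
  by (rule cext_cscale_add[OF _ T]) (use assms in \<open>auto simp: cext_def b_lin_left algebra_simps\<close>)

lemma cext2_comm: "Z \<in> T \<times> T \<Longrightarrow> W \<in> T \<times> T \<Longrightarrow> cext2 b Z W = cext2 b W Z"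
  by (auto simp: cext2_def cext_def b_comm algebra_simps)

lemma cext2_lin2:
  assumes "Z \<in> T \<times> T" "W \<in> T \<times> T" "U \<in> T \<times> T"
  shows "cext2 b U (cscale a Z + cscale c W) = a * cext2 b U Z + c * cext2 b U W"
  using cext2_lin1[OF assms] cext2_comm assms cscale_mem by simp

lemma cext4_lin1:
  assumes "X \<in> T \<times> T" "Y \<in> T \<times> T" "U \<in> T \<times> T" "Z \<in> T \<times> T" "W \<in> T \<times> T"
  shows "cext4 r (cscale a X + cscale c Y) U Z W = a * cext4 r X U Z W + c * cext4 r Y U Z W"
  unfolding cext4_def
  by (rule cext_cscale_add[OF _ T]) (use assms in \<open>auto simp: cext_def r_lin1 algebra_simps\<close>)

lemma cext4_skew12:
  assumes "X \<in> T \<times> T" "Y \<in> T \<times> T" "Z \<in> T \<times> T" "W \<in> T \<times> T"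
  shows "cext4 r X Y Z W = - cext4 r Y X Z W"
proof -
  have "r x y z w = - r y x z w" if "x \<in> {fst X, snd X}" "y \<in> {fst Y, snd Y}" "z \<in> {fst Z, snd Z}" "w \<in> {fst W, snd W}"
    for x y z w using that assms by (intro r_skew12) auto
  note 1 = this
  \<comment> \<open>Fixing the first slot to a component of \<open>X\<close> orients the skew
    symmetry, which makes it a terminating rewrite rule on the sixteen real summands.\<close>
  show ?thesis
    unfolding cext4_def cext_def
    by (simp add: 1[of "fst X"] 1[of "snd X"] algebra_simps)
qed

lemma cext4_skew34:
  assumes "X \<in> T \<times> T" "Y \<in> T \<times> T" "Z \<in> T \<times> T" "W \<in> T \<times> T"
  shows "cext4 r X Y Z W = - cext4 r X Y W Z"
proof -
  have "r x y z w = - r x y w z" if "x \<in> {fst X, snd X}" "y \<in> {fst Y, snd Y}" "z \<in> {fst Z, snd Z}" "w \<in> {fst W, snd W}"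
    for x y z w using that assms by (intro r_skew34) auto
  note 1 = this
  show ?thesis
    unfolding cext4_def cext_def
    by (simp add: 1[of _ _ "fst Z"] 1[of _ _ "snd Z"] algebra_simps)
qed

lemma cext4_lin3:
  assumes "X \<in> T \<times> T" "Y \<in> T \<times> T" "U \<in> T \<times> T" "Z \<in> T \<times> T" "W \<in> T \<times> T"
  shows "cext4 r Z W (cscale a X + cscale c Y) U = a * cext4 r Z W X U + c * cext4 r Z W Y U"
proof -
  have "cext (\<lambda>z. cext (\<lambda>w. complex_of_real (r x y z w)) U) (cscale a X + cscale c Y) =
      a * cext (\<lambda>z. cext (\<lambda>w. complex_of_real (r x y z w)) U) X +
      c * cext (\<lambda>z. cext (\<lambda>w. complex_of_real (r x y z w)) U) Y" if "x \<in> T" "y \<in> T" for x y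
    by (rule cext_cscale_add[OF _ T]) (use assms that in \<open>auto simp: cext_def r_lin3 algebra_simps\<close>)
  note 1 = this
  have 2: "fst Z \<in> T" "snd Z \<in> T" "fst W \<in> T" "snd W \<in> T" using assms by auto
  show ?thesis
    unfolding cext4_def
    by (simp add: cext_def[of _ Z] cext_def[of _ W] 1 2 algebra_simps)
qed

text \<open>In its first two slots the extension is alternating and bilinear, so a change of basis
  of the plane multiplies it by the determinant.\<close>

lemma cext4_base_change12:
  assumes "X \<in> T \<times> T" "Y \<in> T \<times> T" "U \<in> T \<times> T" "V \<in> T \<times> T"
  shows "cext4 r (cscale p X + cscale q Y) (cscale s X + cscale t Y) U V = (p * t - q * s) * cext4 r X Y U V"
proof -
  have alt: "cext4 r Z Z U V = 0" if "Z \<in> T \<times> T" for Z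
    using cext4_skew12[OF that that assms(3,4)] by simp
  have lin2: "cext4 r Z (cscale s X + cscale t Y) U V = s * cext4 r Z X U V + t * cext4 r Z Y U V"
    if "Z \<in> T \<times> T" for Z
    using cext4_lin1[OF assms(1,2) that assms(3,4), of s t] cext4_skew12[OF that _ assms(3,4)]
      assms cscale_mem by simp
  show ?thesis
    using cext4_skew12[OF assms(2,1,3,4)]
    by (simp add: cext4_lin1 cscale_mem assms lin2 alt algebra_simps)
qed

text \<open>Each of the two skew pairs contributes one determinant. The second pair occurs in the
  reversed order \<open>Y\<close>, \<open>X\<close>; its sign is absorbed when
  \<open>Z W Z W\<close> is turned into \<open>Z W W Z\<close>.\<close>

lemma cext4_base_change:
  assumes "Z \<in> T \<times> T" "W \<in> T \<times> T"
    and "X = cscale p Z + cscale q W" "Y = cscale s Z + cscale t W"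
  shows "cext4 r X Y Y X = (p * t - q * s)\<^sup>2 * cext4 r Z W W Z"
proof -
  have XY: "X \<in> T \<times> T" "Y \<in> T \<times> T" using assms cscale_mem by auto
  have flip: "cext4 r Z W U V = (s * q - t * p) * cext4 r Z W Z W" if "U = Y" "V = X" for U V
  proof -
    have lin4: "cext4 r Z W U (cscale p Z + cscale q W) = p * cext4 r Z W U Z + q * cext4 r Z W U W"
      if "U \<in> T \<times> T" for U
      using cext4_lin3[OF assms(1,2) that assms(1,2), of p q] cext4_skew34[OF assms(1,2) that]
        assms(1,2) cscale_mem by simp
    have alt: "cext4 r Z W U U = 0" if "U \<in> T \<times> T" for U
      using cext4_skew34[OF assms(1,2) that that] by simp
    show ?thesis
      unfolding that using cext4_skew34[OF assms(1,2,2,1)] XY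
      by (simp add: assms cext4_lin3 cscale_mem lin4 alt algebra_simps)
  qed
  have "cext4 r X Y Y X = (p * t - q * s) * cext4 r Z W Y X"
    unfolding assms(3)[symmetric] assms(4)[symmetric]
    using cext4_base_change12[OF assms(1,2) XY(2,1), of p q s t] assms(3,4) by simp
  also have "\<dots> = (p * t - q * s)\<^sup>2 * cext4 r Z W W Z"
    unfolding flip[OF refl refl] cext4_skew34[OF assms(1,2,2,1)]
    by (simp add: power2_eq_square algebra_simps)
  finally show ?thesis .
qed

text \<open>Numerator and Gram determinant both scale by the square of the transition determinant,
  so their quotient does not depend on the spanning pair. What has to be excluded is a zero
  determinant, which would turn the quotient into division by 0.\<close>

lemma csectional_curvature_orthonormal:
  assumes Z: "Z \<in> T \<times> T" and W: "W \<in> T \<times> T"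
    and on: "cext2 b Z Z = 1" "cext2 b W W = 1" "cext2 b Z W = 0"
  shows "csectional_curvature b r (cplx.span {Z, W}) = cext4 r Z W W Z"
  unfolding csectional_curvature_def
proof (rule the_equality)
  show "\<exists>X Y. cplx.span {Z, W} = cplx.span {X, Y} \<and>
      cext4 r Z W W Z = cext4 r X Y Y X / (cext2 b X X * cext2 b Y Y - (cext2 b X Y)\<^sup>2)"
    using on by (intro exI[of _ Z] exI[of _ W]) auto
next
  fix k
  assume "\<exists>X Y. cplx.span {Z, W} = cplx.span {X, Y} \<and>
      k = cext4 r X Y Y X / (cext2 b X X * cext2 b Y Y - (cext2 b X Y)\<^sup>2)"
  then obtain X Y where eq: "cplx.span {Z, W} = cplx.span {X, Y}"
    and k: "k = cext4 r X Y Y X / (cext2 b X X * cext2 b Y Y - (cext2 b X Y)\<^sup>2)" by auto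
  have "X \<in> cplx.span {Z, W}" "Y \<in> cplx.span {Z, W}" "Z \<in> cplx.span {X, Y}" "W \<in> cplx.span {X, Y}"
    using eq cplx.span_base[of _ "{X, Y}"] cplx.span_base[of _ "{Z, W}"] by auto
  then obtain p q s t p' q' s' t' where X: "X = cscale p Z + cscale q W"
    and Y: "Y = cscale s Z + cscale t W" and Z': "Z = cscale p' X + cscale q' Y"
    and W': "W = cscale s' X + cscale t' Y"
    by (elim cplx_span_pairE) (rule that)
  have on': "cext2 b W Z = 0" using on(3) cext2_comm Z W by simp
  have XY: "X \<in> T \<times> T" "Y \<in> T \<times> T" using X Y cscale_mem Z W by auto
  \<comment> \<open>Pairing with the orthonormal vectors reads off coordinates. Doing this for
    \<open>Z\<close> and \<open>W\<close>, written in terms of \<open>X\<close> and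
    \<open>Y\<close>, shows that the two transition matrices multiply to the identity.\<close>
  have coeffs: "cext2 b X Z = p" "cext2 b X W = q" "cext2 b Y Z = s" "cext2 b Y W = t"
    unfolding X Y using on on' by (simp_all add: cext2_lin1 Z W)
  have "1 = p' * p + q' * s" "0 = p' * q + q' * t" "0 = s' * p + t' * s" "1 = s' * q + t' * t"
    using cext2_lin1[OF XY Z, of p' q', folded Z', unfolded coeffs on]
      cext2_lin1[OF XY W, of p' q', folded Z', unfolded coeffs on]
      cext2_lin1[OF XY Z, of s' t', folded W', unfolded coeffs on']
      cext2_lin1[OF XY W, of s' t', folded W', unfolded coeffs on] .
  \<comment> \<open>Multiplicativity of the 2 by 2 determinant: the transition determinant is a
    unit.\<close>
  moreover have "(p' * t' - q' * s') * (p * t - q * s) =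
      (p' * p + q' * s) * (s' * q + t' * t) - (p' * q + q' * t) * (s' * p + t' * s)"
    by (simp add: algebra_simps)
  ultimately have "(p' * t' - q' * s') * (p * t - q * s) = 1" by (metis diff_zero mult_1 mult_zero_left)
  then have nz: "p * t - q * s \<noteq> 0" by auto
  have "cext2 b X X * cext2 b Y Y - (cext2 b X Y)\<^sup>2 = (p * t - q * s)\<^sup>2"
    unfolding X Y using on on' by (simp add: cext2_lin1 cext2_lin2 cscale_mem Z W)
      (simp add: power2_eq_square algebra_simps)
  then show "k = cext4 r Z W W Z"
    unfolding k cext4_base_change[OF Z W X Y] using nz by simp
qed

section \<open>The complexified endomorphism and its invariant planes\<close>

abbreviation J :: "'v \<times> 'v \<Rightarrow> 'v \<times> 'v" where "J \<equiv> map_prod j j"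

lemma J_mem: "Z \<in> T \<times> T \<Longrightarrow> J Z \<in> T \<times> T"
  using j_mem by auto

lemma J_lin:
  assumes "Z \<in> T \<times> T" "W \<in> T \<times> T"
  shows "J (cscale a Z + cscale c W) = cscale a (J Z) + cscale c (J W)"
proof -
  obtain z1 z2 w1 w2 where ZW: "Z = (z1, z2)" "W = (w1, w2)" by fastforce
  with assms have mem: "z1 \<in> T" "z2 \<in> T" "w1 \<in> T" "w2 \<in> T" by auto
  have 1: "j (p *\<^sub>R z1 + q *\<^sub>R z2 + (s *\<^sub>R w1 + t *\<^sub>R w2)) =
      p *\<^sub>R j z1 + q *\<^sub>R j z2 + (s *\<^sub>R j w1 + t *\<^sub>R j w2)" for p q s t :: real
    using j_lin[OF T[OF mem(1,2)] T[OF mem(3,4)], of 1 p q 1 s t] j_lin[OF mem(1,2)] j_lin[OF mem(3,4)] by simp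
  show ?thesis
    using 1[of "Re a" "- Im a" "Re c" "- Im c"] 1[of "Im a" "Re a" "Im c" "Re c"]
    by (simp add: cscale_def ZW)
qed

lemma J_J: "Z \<in> T \<times> T \<Longrightarrow> J (J Z) = cscale (-1) Z"
  by (auto simp: cscale_def j_j)

lemma cext2_J: "Z \<in> T \<times> T \<Longrightarrow> W \<in> T \<times> T \<Longrightarrow> cext2 b (J Z) (J W) = cext2 b Z W"
  by (auto simp: cext2_def cext_def b_j)

text \<open>Skew symmetry of the fundamental 2-form: apply the isometry \<open>j\<close> to both
  arguments and use \<open>j (j v) = - v\<close>.\<close>

lemma b_j_skew: "u \<in> T \<Longrightarrow> v \<in> T \<Longrightarrow> b u (j v) = - b v (j u)"
  using b_j[of u "j v"] b_scale(2)[of "j u" v "-1"] b_comm[of "j u" v] by (simp add: j_mem j_j)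

text \<open>The complex extension of a skew form is alternating. Thus \<open>Z\<close> and
  \<open>JZ\<close> are orthogonal for complex \<open>Z\<close> as well, however its real and
  imaginary parts lie.\<close>

lemma cext2_J_self: "Z \<in> T \<times> T \<Longrightarrow> cext2 b Z (J Z) = 0"
  using b_j_skew[of "fst Z" "fst Z"] b_j_skew[of "snd Z" "snd Z"] b_j_skew[of "fst Z" "snd Z"]
  by (auto simp: cext2_def cext_def)

text \<open>Turns a bound over planes into a bound on a quartic expression in \<open>Z\<close>: each
  \<open>Z\<close> with \<open>g(Z, Z) = 1\<close> has an orthonormal partner \<open>JZ\<close>, and
  their span is \<open>J\<close>-stable because \<open>J\<close> squares to -1.\<close>

lemma holomorphic_curvature_plane:
  assumes Z: "Z \<in> T \<times> T" and unit: "cext2 b Z Z = 1"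
  defines "\<alpha> \<equiv> cplx.span {Z, J Z}"
  shows "complex_plane T \<alpha>" "holomorphic_plane j \<alpha>" "signature_pp b \<alpha>"
    "csectional_curvature b r \<alpha> = cext4 r Z (J Z) (J Z) Z"
proof -
  note JZ = J_mem[OF Z]
  have on: "cext2 b Z Z = 1" "cext2 b (J Z) (J Z) = 1" "cext2 b Z (J Z) = 0"
    using unit cext2_J[OF Z Z] cext2_J_self[OF Z] by auto
  have on': "cext2 b (J Z) Z = 0" using on(3) cext2_comm[OF Z JZ] by simp
  show "signature_pp b \<alpha>" unfolding signature_pp_def \<alpha>_def using on by blast
  show "csectional_curvature b r \<alpha> = cext4 r Z (J Z) (J Z) Z"
    unfolding \<alpha>_def by (rule csectional_curvature_orthonormal[OF Z JZ on])
  \<comment> \<open>Pairing the relation with \<open>Z\<close> and with \<open>JZ\<close> isolates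
    the two coefficients.\<close>
  have indep: "a = 0 \<and> c = 0" if "cscale a Z + cscale c (J Z) = 0" for a c
  proof -
    have zero: "cext2 b 0 U = 0" if "U \<in> T \<times> T" for U
      using cext2_lin1[OF Z Z that, of 0 0] by simp
    show ?thesis
      using cext2_lin1[OF Z JZ Z, of a c] cext2_lin1[OF Z JZ JZ, of a c] on on' that
        zero[OF Z] zero[OF JZ] by (simp del: cplx.scale_eq_0_iff)
  qed
  have ne: "Z \<noteq> J Z" using on by auto
  have "cplx.independent {Z, J Z}"
  proof (rule cplx.independent_insertI)
    show "Z \<notin> cplx.span {J Z}"
      using indep[of 1] by (auto simp: cplx.span_singleton) (metis add.right_inverse cplx.scale_minus_left zero_neq_one)
    have "J Z \<noteq> 0" using indep[of 0 1] by auto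
    then show "cplx.independent {J Z}" by simp
  qed
  then have "cplx.dim \<alpha> = 2"
    unfolding \<alpha>_def by (subst cplx.dim_span_eq_card_independent) (use ne in auto)
  moreover have "\<alpha> \<subseteq> T \<times> T"
    unfolding \<alpha>_def cplx_span_pair using cscale_mem[OF Z JZ] by blast
  ultimately show "complex_plane T \<alpha>"
    unfolding complex_plane_def by (auto simp: \<alpha>_def cplx.subspace_span)
  have J: "J (cscale a Z + cscale c (J Z)) = cscale (- c) Z + cscale a (J Z)" for a c
    using J_lin[OF Z JZ] J_J[OF Z] by (simp add: add.commute)
  show "holomorphic_plane j \<alpha>"
    unfolding holomorphic_plane_def
  proof (intro equalityI subsetI)
    fix V assume "V \<in> \<alpha>"
    then obtain a c where V: "V = cscale a Z + cscale c (J Z)" unfolding \<alpha>_def cplx_span_pair by auto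
    \<comment> \<open>The preimage is \<open>- J V\<close>, since the inverse of \<open>J\<close> is
      its negative.\<close>
    have "V = J (cscale c Z + cscale (- a) (J Z))" using J[of c "-a"] V by simp
    then show "V \<in> J ` \<alpha>" unfolding \<alpha>_def cplx_span_pair by blast
  next
    fix V assume "V \<in> J ` \<alpha>"
    then obtain a c where V: "V = J (cscale a Z + cscale c (J Z))"
      unfolding \<alpha>_def by (elim imageE cplx_span_pairE) (simp only:)
    then show "V \<in> \<alpha>" unfolding \<alpha>_def cplx_span_pair J by blast
  qed
qed

section \<open>The holomorphic curvature as a quartic form\<close>

definition H :: "'v \<Rightarrow> real" where "H z = r z (j z) (j z) z"

text \<open>One quartic form, evaluated at \<open>p x + q y\<close> and at
  \<open>p x + \<i> q y\<close>. Replacing \<open>q\<close> by \<open>\<i> q\<close> multiplies the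
  five terms by 1, \<open>\<i>\<close>, -1, \<open>-\<i>\<close>, 1, so the even coefficients give
  the real part and the odd ones the imaginary part. Sharing \<open>c1\<close>, \<open>c2\<close>,
  \<open>c3\<close> lets information on complex vectors flow back to real ones.\<close>

lemma H_combination:
  assumes x: "x \<in> T" and y: "y \<in> T"
  obtains c1 c2 c3 where
    "\<And>p q. H (p *\<^sub>R x + q *\<^sub>R y) = p^4 * H x + p^3 * q * c1 + p\<^sup>2 * q\<^sup>2 * c2 + p * q^3 * c3 + q^4 * H y"
    "\<And>p q. cext4 r (p *\<^sub>R x, q *\<^sub>R y) (J (p *\<^sub>R x, q *\<^sub>R y)) (J (p *\<^sub>R x, q *\<^sub>R y)) (p *\<^sub>R x, q *\<^sub>R y) =
      Complex (p^4 * H x - p\<^sup>2 * q\<^sup>2 * c2 + q^4 * H y) (p^3 * q * c1 - p * q^3 * c3)"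
proof
  \<comment> \<open>The coefficient with index k sums all placements of \<open>y\<close> in exactly
    k of the four slots.\<close>
  let ?c1 = "r y (j x) (j x) x + r x (j y) (j x) x + r x (j x) (j y) x + r x (j x) (j x) y"
  let ?c2 = "r y (j y) (j x) x + r y (j x) (j y) x + r y (j x) (j x) y + r x (j y) (j y) x
    + r x (j y) (j x) y + r x (j x) (j y) y"
  let ?c3 = "r x (j y) (j y) y + r y (j x) (j y) y + r y (j y) (j x) y + r y (j y) (j y) x"
  show "H (p *\<^sub>R x + q *\<^sub>R y) = p^4 * H x + p^3 * q * ?c1 + p\<^sup>2 * q\<^sup>2 * ?c2 + p * q^3 * ?c3 + q^4 * H y" for p q
    unfolding H_def j_lin[OF x y]
    by (simp add: r_lin1 r_lin2 r_lin3 r_lin4 x y j_mem T power2_eq_square power3_eq_cube power4_eq_xxxx algebra_simps)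
  show "cext4 r (p *\<^sub>R x, q *\<^sub>R y) (J (p *\<^sub>R x, q *\<^sub>R y)) (J (p *\<^sub>R x, q *\<^sub>R y)) (p *\<^sub>R x, q *\<^sub>R y) =
      Complex (p^4 * H x - p\<^sup>2 * q\<^sup>2 * ?c2 + q^4 * H y) (p^3 * q * ?c1 - p * q^3 * ?c3)" for p q
    unfolding H_def
    by (simp add: cext4_def cext_def j_scale r_scale x y j_mem scale_mem complex_eq_iff
        power2_eq_square power3_eq_cube power4_eq_xxxx algebra_simps)
qed

text \<open>The vector \<open>cosh t x + \<i> sinh t y\<close>, with \<open>s = sinh t\<close>.\<close>

lemma hyperbolic_unit:
  assumes "x \<in> T" "y \<in> T" "b x x = 1" "b y y = 1" "b x y = 0"
  shows "cext2 b (sqrt (1 + s\<^sup>2) *\<^sub>R x, s *\<^sub>R y) (sqrt (1 + s\<^sup>2) *\<^sub>R x, s *\<^sub>R y) = 1"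
proof -
  have "sqrt (1 + s\<^sup>2) * sqrt (1 + s\<^sup>2) = 1 + s\<^sup>2" by simp
  then show ?thesis
    using assms b_comm[of y x]
    by (simp add: cext2_def cext_def b_scale scale_mem complex_eq_iff power2_eq_square)
qed

lemma H_orthonormal_if_Re_bounded:
  assumes bound: "\<And>\<alpha>. complex_plane T \<alpha> \<Longrightarrow> holomorphic_plane j \<alpha> \<Longrightarrow> signature_pp b \<alpha> \<Longrightarrow>
      \<bar>Re (csectional_curvature b r \<alpha>)\<bar> \<le> c"
    and xy: "x \<in> T" "y \<in> T" "b x x = 1" "b y y = 1" "b x y = 0"
  shows "H x = H y"
proof -
  obtain c1 c2 c3 where eq: "\<And>p q. cext4 r (p *\<^sub>R x, q *\<^sub>R y) (J (p *\<^sub>R x, q *\<^sub>R y)) (J (p *\<^sub>R x, q *\<^sub>R y)) (p *\<^sub>R x, q *\<^sub>R y) =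
      Complex (p^4 * H x - p\<^sup>2 * q\<^sup>2 * c2 + q^4 * H y) (p^3 * q * c1 - p * q^3 * c3)"
    using H_combination[OF xy(1,2)] by metis
  \<comment> \<open>These are the coefficients of \<open>u\<close> and \<open>u^2\<close> after
    substituting \<open>p^2 = 1 + u\<close> and \<open>q^2 = u\<close>. Subtracting one equation
    from the other eliminates \<open>c2\<close> and leaves \<open>H x - H y = 0\<close>.\<close>
  have "2 * H x - c2 = 0 \<and> H x - c2 + H y = 0"
  proof (rule bounded_quadratic_coeffs_zero)
    fix u :: real assume u: "u \<ge> 0"
    define s p where "s = sqrt u" and "p = sqrt (1 + s\<^sup>2)"
    have s: "s\<^sup>2 = u" and p: "p\<^sup>2 = 1 + u" using u by (auto simp: s_def p_def)
    have 4: "s ^ 4 = u\<^sup>2" "p ^ 4 = (1 + u)\<^sup>2"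
      using s p power_mult[of s 2 2] power_mult[of p 2 2] by auto
    have Z: "(p *\<^sub>R x, s *\<^sub>R y) \<in> T \<times> T" using xy by (auto intro: scale_mem)
    have unit: "cext2 b (p *\<^sub>R x, s *\<^sub>R y) (p *\<^sub>R x, s *\<^sub>R y) = 1"
      unfolding p_def by (rule hyperbolic_unit[OF xy])
    have "\<bar>Re (cext4 r (p *\<^sub>R x, s *\<^sub>R y) (J (p *\<^sub>R x, s *\<^sub>R y)) (J (p *\<^sub>R x, s *\<^sub>R y)) (p *\<^sub>R x, s *\<^sub>R y))\<bar> \<le> c"
      using bound[OF holomorphic_curvature_plane(1-3)[OF Z unit]]
      unfolding holomorphic_curvature_plane(4)[OF Z unit] .
    then have "\<bar>(1 + u)\<^sup>2 * H x - (1 + u) * u * c2 + u\<^sup>2 * H y\<bar> \<le> c"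
      by (simp only: eq complex.sel s p 4)
    then show "\<bar>H x + (2 * H x - c2) * u + (H x - c2 + H y) * u\<^sup>2\<bar> \<le> c"
      by (simp add: power2_eq_square algebra_simps)
  qed
  then show ?thesis by simp
qed

text \<open>The imaginary part is \<open>p s ((1 + u) c1 - u c3)\<close>, with
  \<open>u = s^2\<close> and \<open>p^2 = 1 + u\<close>. Replacing the irrational factor
  \<open>p s\<close> by the smaller \<open>u\<close> keeps the bound and yields a polynomial in
  \<open>u\<close> without constant term, whose coefficients are \<open>c1\<close> and
  \<open>c1 - c3\<close>. Hence both odd coefficients vanish.\<close>

lemma H_even_if_Im_bounded:
  assumes bound: "\<And>\<alpha>. complex_plane T \<alpha> \<Longrightarrow> holomorphic_plane j \<alpha> \<Longrightarrow> signature_pp b \<alpha> \<Longrightarrow>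
      \<bar>Im (csectional_curvature b r \<alpha>)\<bar> \<le> c"
    and xy: "x \<in> T" "y \<in> T" "b x x = 1" "b y y = 1" "b x y = 0"
  shows "H (p *\<^sub>R x + q *\<^sub>R y) = H (p *\<^sub>R x + (- q) *\<^sub>R y)"
proof -
  obtain c1 c2 c3 where eq: "\<And>p q. cext4 r (p *\<^sub>R x, q *\<^sub>R y) (J (p *\<^sub>R x, q *\<^sub>R y)) (J (p *\<^sub>R x, q *\<^sub>R y)) (p *\<^sub>R x, q *\<^sub>R y) =
      Complex (p^4 * H x - p\<^sup>2 * q\<^sup>2 * c2 + q^4 * H y) (p^3 * q * c1 - p * q^3 * c3)"
    and H: "\<And>p q. H (p *\<^sub>R x + q *\<^sub>R y) = p^4 * H x + p^3 * q * c1 + p\<^sup>2 * q\<^sup>2 * c2 + p * q^3 * c3 + q^4 * H y"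
    using H_combination[OF xy(1,2)] by metis
  have "c1 = 0 \<and> c1 - c3 = 0"
  proof (rule bounded_quadratic_coeffs_zero)
    fix u :: real assume u: "u \<ge> 0"
    define s p where "s = sqrt u" and "p = sqrt (1 + s\<^sup>2)"
    have s: "s\<^sup>2 = u" "s \<ge> 0" and p: "p\<^sup>2 = 1 + u" "p \<ge> 0" using u by (auto simp: s_def p_def)
    have "s\<^sup>2 \<le> p\<^sup>2" unfolding s p by simp
    then have "s \<le> p" using p(2) by (rule power2_le_imp_le)
    \<comment> \<open>This is \<open>sinh^2 t \<le> cosh t sinh t\<close> for nonnegative
      \<open>t\<close>.\<close>
    then have sp: "u \<le> p * s" using s mult_right_mono[of s p s] by (simp add: power2_eq_square)
    have Z: "(p *\<^sub>R x, s *\<^sub>R y) \<in> T \<times> T" using xy by (auto intro: scale_mem)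
    have unit: "cext2 b (p *\<^sub>R x, s *\<^sub>R y) (p *\<^sub>R x, s *\<^sub>R y) = 1"
      unfolding p_def by (rule hyperbolic_unit[OF xy])
    have "\<bar>Im (cext4 r (p *\<^sub>R x, s *\<^sub>R y) (J (p *\<^sub>R x, s *\<^sub>R y)) (J (p *\<^sub>R x, s *\<^sub>R y)) (p *\<^sub>R x, s *\<^sub>R y))\<bar> \<le> c"
      using bound[OF holomorphic_curvature_plane(1-3)[OF Z unit]]
      unfolding holomorphic_curvature_plane(4)[OF Z unit] .
    moreover have "p^3 * s * c1 - p * s^3 * c3 = (p * s) * (p\<^sup>2 * c1 - s\<^sup>2 * c3)"
      by (simp add: power2_eq_square power3_eq_cube algebra_simps)
    ultimately have "(p * s) * \<bar>(1 + u) * c1 - u * c3\<bar> \<le> c"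
      using s p by (simp only: eq complex.sel abs_mult abs_of_nonneg)
    moreover have "u * \<bar>(1 + u) * c1 - u * c3\<bar> \<le> (p * s) * \<bar>(1 + u) * c1 - u * c3\<bar>"
      using sp by (intro mult_right_mono) auto
    moreover have "u * \<bar>(1 + u) * c1 - u * c3\<bar> = \<bar>u * ((1 + u) * c1 - u * c3)\<bar>"
      using u by (simp add: abs_mult)
    ultimately show "\<bar>0 + c1 * u + (c1 - c3) * u\<^sup>2\<bar> \<le> c"
      by (simp add: power2_eq_square algebra_simps)
  qed
  then show ?thesis by (simp only: H) simp
qed

lemma H_orthonormal_if_Im_bounded:
  assumes bound: "\<And>\<alpha>. complex_plane T \<alpha> \<Longrightarrow> holomorphic_plane j \<alpha> \<Longrightarrow> signature_pp b \<alpha> \<Longrightarrow>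
      \<bar>Im (csectional_curvature b r \<alpha>)\<bar> \<le> c"
    and xy: "x \<in> T" "y \<in> T" "b x x = 1" "b y y = 1" "b x y = 0"
  shows "H x = H y"
proof -
  define h where "h = 1 / sqrt (2::real)"
  have h: "h * h = 1 / 2" by (simp add: h_def)
  let ?x = "h *\<^sub>R x + h *\<^sub>R y" and ?y = "h *\<^sub>R x + (- h) *\<^sub>R y"
  have mem: "?x \<in> T" "?y \<in> T" using T xy by blast+
  have on: "b ?x ?x = 1" "b ?y ?y = 1" "b ?x ?y = 0"
    using xy b_comm[of y x] h by (simp_all only: b_lin b_lin_left mem) (simp_all add: algebra_simps)
  \<comment> \<open>The rotation is its own inverse: since \<open>2 h^2 = 1\<close>, the sum and the
    difference of the rotated vectors, scaled by \<open>h\<close>, are again \<open>x\<close> and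
    \<open>y\<close>. Evenness for the rotated pair therefore compares \<open>H x\<close> with
    \<open>H y\<close>.\<close>
  have "h *\<^sub>R ?x + h *\<^sub>R ?y = (h * h + h * h) *\<^sub>R x"
    by (simp only: scaleR_add_right scaleR_scaleR scaleR_add_left) simp
  moreover have "h *\<^sub>R ?x + (- h) *\<^sub>R ?y = (h * h + h * h) *\<^sub>R y"
    by (simp only: scaleR_add_right scaleR_scaleR scaleR_add_left) simp
  ultimately show ?thesis
    using H_even_if_Im_bounded[OF bound mem on, of h h] h by simp
qed

text \<open>Arbitrary unit vectors \<open>x\<close> and \<open>y\<close> are compared through a
  third one orthogonal to both; \<open>perp\<close> is the form in which the dimension enters the
  algebra.\<close>

lemma H_constant:
  assumes bound: "(\<forall>\<alpha>. complex_plane T \<alpha> \<and> holomorphic_plane j \<alpha> \<and> signature_pp b \<alpha> \<longrightarrow>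
      \<bar>Re (csectional_curvature b r \<alpha>)\<bar> \<le> c) \<or>
    (\<forall>\<alpha>. complex_plane T \<alpha> \<and> holomorphic_plane j \<alpha> \<and> signature_pp b \<alpha> \<longrightarrow>
      \<bar>Im (csectional_curvature b r \<alpha>)\<bar> \<le> c)"
    and perp: "\<And>x y. x \<in> T \<Longrightarrow> y \<in> T \<Longrightarrow> \<exists>z\<in>T. z \<noteq> 0 \<and> b x z = 0 \<and> b y z = 0"
  shows "\<exists>k. \<forall>x\<in>T. b x x = 1 \<longrightarrow> r x (j x) (j x) x = k"
proof -
  have orth: "H x = H y" if "x \<in> T" "y \<in> T" "b x x = 1" "b y y = 1" "b x y = 0" for x y
    using bound H_orthonormal_if_Re_bounded[OF _ that] H_orthonormal_if_Im_bounded[OF _ that] by blast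
  have "H x = H y" if x: "x \<in> T" "b x x = 1" and y: "y \<in> T" "b y y = 1" for x y
  proof -
    obtain z where z: "z \<in> T" "z \<noteq> 0" "b x z = 0" "b y z = 0" using perp[OF x(1) y(1)] by auto
    define w where "w = (1 / sqrt (b z z)) *\<^sub>R z"
    have "b z z > 0" using b_pos z by auto
    then have "b w w = 1" "w \<in> T" "b x w = 0" "b y w = 0"
      using z x y by (auto simp: w_def b_scale scale_mem)
    then show ?thesis using orth[of x w] orth[of y w] x y by simp
  qed
  then show ?thesis unfolding H_def by (metis (no_types))
qed

end

section \<open>Tangent vectors and coordinate fields\<close>

locale atlas_manifold =
  fixes M :: "'a topology" and \<A> :: "('a, 'e::euclidean_space) chart set"
  assumes smooth_manifold: "smooth_manifold M \<A>"
begin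

section \<open>Charts and smooth functions\<close>

lemma chart_cover: "p \<in> topspace M \<Longrightarrow> \<exists>V \<phi>. (V, \<phi>) \<in> \<A> \<and> p \<in> V"
  using smooth_manifold unfolding smooth_manifold_def smooth_atlas_def by blast

lemma chart_openin: "(V, \<phi>) \<in> \<A> \<Longrightarrow> openin M V"
  using smooth_manifold unfolding smooth_manifold_def smooth_atlas_def by blast

lemma chart_homeomorphic:
  "(V, \<phi>) \<in> \<A> \<Longrightarrow> homeomorphic_map (subtopology M V) (top_of_set (\<phi> ` V)) \<phi>"
  using smooth_manifold unfolding smooth_manifold_def smooth_atlas_def by blast

lemma chart_open_range: "(V, \<phi>) \<in> \<A> \<Longrightarrow> open (\<phi> ` V)"
  using smooth_manifold unfolding smooth_manifold_def smooth_atlas_def by blast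

lemma chart_transition:
  "(V, \<phi>) \<in> \<A> \<Longrightarrow> (W, \<psi>) \<in> \<A> \<Longrightarrow> smooth_on (\<phi> ` (V \<inter> W)) (\<psi> \<circ> inv_into V \<phi>)"
  using smooth_manifold unfolding smooth_manifold_def smooth_atlas_def by blast

lemma chart_topspace: "(V, \<phi>) \<in> \<A> \<Longrightarrow> topspace (subtopology M V) = V"
  using chart_openin openin_subset by (metis topspace_subtopology_subset)

lemma chart_inj: "(V, \<phi>) \<in> \<A> \<Longrightarrow> inj_on \<phi> V"
  using homeomorphic_imp_injective_map[OF chart_homeomorphic] chart_topspace by metis

lemma inv_chart: "(V, \<phi>) \<in> \<A> \<Longrightarrow> q \<in> V \<Longrightarrow> inv_into V \<phi> (\<phi> q) = q"
  using chart_inj by simp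

lemma chart_image_open:
  assumes c: "(V, \<phi>) \<in> \<A>" and "openin M W" "W \<subseteq> V"
  shows "open (\<phi> ` W)"
proof -
  have "openin (subtopology M V) W"
    using assms chart_openin[OF c] by (simp add: openin_open_subtopology)
  then have "openin (top_of_set (\<phi> ` V)) (\<phi> ` W)"
    using homeomorphic_map_openness[OF chart_homeomorphic[OF c]] chart_topspace[OF c] assms(3) by metis
  then show ?thesis
    using chart_open_range[OF c] by (simp add: openin_open_eq)
qed

lemma chart_preimage_open:
  assumes c: "(V, \<phi>) \<in> \<A>" and B: "open B"
  shows "openin M {q \<in> V. \<phi> q \<in> B}"
proof -
  have "openin (subtopology M V) {q \<in> topspace (subtopology M V). \<phi> q \<in> B \<inter> \<phi> ` V}"
    using homeomorphic_imp_continuous_map[OF chart_homeomorphic[OF c]] B chart_open_range[OF c]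
    by (intro openin_continuous_map_preimage) (auto simp: openin_open_eq)
  moreover have "{q \<in> topspace (subtopology M V). \<phi> q \<in> B \<inter> \<phi> ` V} = {q \<in> V. \<phi> q \<in> B}"
    using chart_topspace[OF c] by auto
  ultimately show ?thesis
    using chart_openin[OF c] by (simp add: openin_open_subtopology)
qed

lemma chart_image_Int_open: "(V, \<phi>) \<in> \<A> \<Longrightarrow> openin M U \<Longrightarrow> open (\<phi> ` (U \<inter> V))"
  using chart_image_open chart_openin by (metis inf_le2 openin_Int)

lemma smooth_fun_subset:
  "smooth_fun \<A> U f \<Longrightarrow> U' \<subseteq> U \<Longrightarrow> smooth_fun \<A> U' f"
  unfolding smooth_fun_def by (fast intro: smooth_on_subset)

lemma smooth_fun_const: "openin M U \<Longrightarrow> smooth_fun \<A> U (\<lambda>q. c)"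
  unfolding smooth_fun_def o_def by (auto intro!: smooth_on_const chart_image_Int_open)

lemma smooth_fun_add:
  "openin M U \<Longrightarrow> smooth_fun \<A> U f \<Longrightarrow> smooth_fun \<A> U h \<Longrightarrow> smooth_fun \<A> U (\<lambda>q. f q + h q)"
  unfolding smooth_fun_def o_def by (auto intro!: smooth_on_add chart_image_Int_open)

lemma smooth_fun_mult:
  "openin M U \<Longrightarrow> smooth_fun \<A> U f \<Longrightarrow> smooth_fun \<A> U h \<Longrightarrow> smooth_fun \<A> U (\<lambda>q. f q * h q)"
  unfolding smooth_fun_def o_def by (auto intro!: smooth_on_mult chart_image_Int_open)

text \<open>\<open>smooth_fun\<close> quantifies over all charts of the atlas; composing with smooth
  transition maps reduces the check to one chart containing \<open>U\<close>.\<close>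

lemma smooth_fun_chartI:
  assumes c: "(V, \<phi>) \<in> \<A>" and U: "openin M U" "U \<subseteq> V"
    and F: "smooth_on (\<phi> ` U) F" and f: "\<And>q. q \<in> U \<Longrightarrow> f q = F (\<phi> q)"
  shows "smooth_fun \<A> U f"
  unfolding smooth_fun_def
proof (intro ballI, clarify)
  fix W \<psi> assume d: "(W, \<psi>) \<in> \<A>"
  note op = chart_image_Int_open[OF d U(1)]
  have "smooth_on (\<psi> ` (U \<inter> W)) (\<lambda>x. F ((\<phi> \<circ> inv_into W \<psi>) x))"
  proof (rule smooth_on_compose[OF op chart_image_open[OF c U]])
    show "(\<phi> \<circ> inv_into W \<psi>) ` \<psi> ` (U \<inter> W) \<subseteq> \<phi> ` U" by (auto simp: inv_chart[OF d])
    show "smooth_on (\<psi> ` (U \<inter> W)) (\<phi> \<circ> inv_into W \<psi>)"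
      using smooth_on_subset[OF chart_transition[OF d c]] U(2) by (metis Int_mono Int_commute image_mono order_refl)
  qed (fact F)
  then show "smooth_on (\<psi> ` (U \<inter> W)) (f \<circ> inv_into W \<psi>)"
    by (subst smooth_on_cong[OF op, of _ "\<lambda>x. F ((\<phi> \<circ> inv_into W \<psi>) x)"]) (auto simp: inv_chart[OF d] f)
qed

lemma smooth_fun_chartD:
  assumes "(V, \<phi>) \<in> \<A>" "U \<subseteq> V" "smooth_fun \<A> U f"
  shows "smooth_on (\<phi> ` U) (f \<circ> inv_into V \<phi>)"
proof -
  have "U \<inter> V = U" using assms(2) by auto
  then show ?thesis using assms(1,3) unfolding smooth_fun_def by force
qed

lemma smooth_fun_coordinate:
  assumes c: "(V, \<phi>) \<in> \<A>"
  shows "smooth_fun \<A> V (\<lambda>q. \<phi> q \<bullet> b)"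
  by (rule smooth_fun_chartI[OF c chart_openin[OF c] order_refl, of "\<lambda>x. x \<bullet> b"])
     (auto intro!: smooth_on_bounded_linear[OF _ bounded_linear_inner_left] smooth_on_ident chart_open_range[OF c])

section \<open>Derivations of germs\<close>

abbreviation "near \<equiv> smooth_near M \<A>"
abbreviation "Tan \<equiv> tangent_space M \<A>"
abbreviation "vfield \<equiv> vector_field M \<A>"

lemma nearI: "openin M U \<Longrightarrow> p \<in> U \<Longrightarrow> smooth_fun \<A> U f \<Longrightarrow> near p f"
  unfolding smooth_near_def by blast

lemma near_const: "p \<in> topspace M \<Longrightarrow> near p (\<lambda>q. c)"
  using nearI smooth_fun_const by blast

lemma near_common:
  assumes "near p f" "near p h"
  obtains U where "openin M U" "p \<in> U" "smooth_fun \<A> U f" "smooth_fun \<A> U h"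
proof -
  obtain U V where "openin M U" "p \<in> U" "smooth_fun \<A> U f" "openin M V" "p \<in> V" "smooth_fun \<A> V h"
    using assms unfolding smooth_near_def by blast
  then show ?thesis
    using that[of "U \<inter> V"] smooth_fun_subset by (meson IntI inf_le1 inf_le2 openin_Int)
qed

lemma near_add: "near p f \<Longrightarrow> near p h \<Longrightarrow> near p (\<lambda>q. f q + h q)"
  by (erule (1) near_common) (blast intro: nearI smooth_fun_add)

lemma near_mult: "near p f \<Longrightarrow> near p h \<Longrightarrow> near p (\<lambda>q. f q * h q)"
  by (erule (1) near_common) (blast intro: nearI smooth_fun_mult)

lemma near_topspace: "near p f \<Longrightarrow> p \<in> topspace M"
  unfolding smooth_near_def using openin_subset by blast

lemma near_sum:
  assumes "p \<in> topspace M" "\<And>i. i \<in> I \<Longrightarrow> near p (f i)"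
  shows "near p (\<lambda>q. \<Sum>i\<in>I. f i q)"
  using assms(2)
  by (induction I rule: infinite_finite_induct)
     (auto intro: near_add near_const assms(1))

lemma Tan_outside: "v \<in> Tan p \<Longrightarrow> \<not> near p f \<Longrightarrow> v f = 0"
  unfolding tangent_space_def by blast

lemma Tan_linear:
  "v \<in> Tan p \<Longrightarrow> near p f \<Longrightarrow> near p h \<Longrightarrow> v (\<lambda>q. a * f q + b * h q) = a * v f + b * v h"
  unfolding tangent_space_def by blast

lemma Tan_mult:
  "v \<in> Tan p \<Longrightarrow> near p f \<Longrightarrow> near p h \<Longrightarrow> v (\<lambda>q. f q * h q) = v f * h p + f p * v h"
  unfolding tangent_space_def by blast

lemma Tan_cong:
  "v \<in> Tan p \<Longrightarrow> near p f \<Longrightarrow> near p h \<Longrightarrow> openin M U \<Longrightarrow> p \<in> U \<Longrightarrow> (\<And>q. q \<in> U \<Longrightarrow> f q = h q) \<Longrightarrow> v f = v h"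
  unfolding tangent_space_def by blast

lemma Tan_add: "v \<in> Tan p \<Longrightarrow> near p f \<Longrightarrow> near p h \<Longrightarrow> v (\<lambda>q. f q + h q) = v f + v h"
  using Tan_linear[of v p f h 1 1] by simp

lemma Tan_cmult: "v \<in> Tan p \<Longrightarrow> near p f \<Longrightarrow> v (\<lambda>q. a * f q) = a * v f"
  using Tan_linear[of v p f f a 0] by simp

text \<open>The Leibniz rule for \<open>1 * 1\<close> gives \<open>v 1 = 2 * v 1\<close>;
  homogeneity then covers every constant.\<close>

lemma Tan_const:
  assumes "v \<in> Tan p" "p \<in> topspace M"
  shows "v (\<lambda>q. c) = 0"
  using Tan_mult[OF assms(1) near_const[OF assms(2)] near_const[OF assms(2)], of 1 1]
    Tan_cmult[OF assms(1) near_const[OF assms(2)], of c 1]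
  by simp

lemma Tan_sum:
  assumes v: "v \<in> Tan p" and p: "p \<in> topspace M" and f: "\<And>i. i \<in> I \<Longrightarrow> near p (f i)"
  shows "v (\<lambda>q. \<Sum>i\<in>I. f i q) = (\<Sum>i\<in>I. v (f i))"
  using f
proof (induction I rule: infinite_finite_induct)
  case (insert x F)
  then show ?case
    using Tan_add[OF v, of "f x" "\<lambda>q. \<Sum>i\<in>F. f i q"] near_sum[OF p, of F f] by simp
qed (auto simp: Tan_const[OF v p])

lemma Tan_combination:
  assumes "v \<in> Tan p" "w \<in> Tan p"
  shows "a *\<^sub>R v + c *\<^sub>R w \<in> Tan p"
  unfolding tangent_space_def
proof (intro CollectI conjI allI impI)
  fix f assume "\<not> near p f"
  then show "(a *\<^sub>R v + c *\<^sub>R w) f = 0"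
    using Tan_outside[OF assms(1)] Tan_outside[OF assms(2)] by (simp add: scaleR_fun_def)
next
  fix f h s t assume fh: "near p f" "near p h"
  show "(a *\<^sub>R v + c *\<^sub>R w) (\<lambda>q. s * f q + t * h q) =
      s * (a *\<^sub>R v + c *\<^sub>R w) f + t * (a *\<^sub>R v + c *\<^sub>R w) h"
    using Tan_linear[OF assms(1) fh] Tan_linear[OF assms(2) fh] by (simp add: scaleR_fun_def algebra_simps)
  show "(a *\<^sub>R v + c *\<^sub>R w) (\<lambda>q. f q * h q) = (a *\<^sub>R v + c *\<^sub>R w) f * h p + f p * (a *\<^sub>R v + c *\<^sub>R w) h"
    using Tan_mult[OF assms(1) fh] Tan_mult[OF assms(2) fh] by (simp add: scaleR_fun_def algebra_simps)
  assume "\<exists>U. openin M U \<and> p \<in> U \<and> (\<forall>q\<in>U. f q = h q)"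
  then have "v f = v h" "w f = w h"
    using Tan_cong[OF assms(1) fh] Tan_cong[OF assms(2) fh] by blast+
  then show "(a *\<^sub>R v + c *\<^sub>R w) f = (a *\<^sub>R v + c *\<^sub>R w) h"
    by (simp add: scaleR_fun_def)
qed

lemma Tan_scale: "v \<in> Tan p \<Longrightarrow> a *\<^sub>R v \<in> Tan p"
  using Tan_combination[of v p v a 0] by simp

lemma Tan_plus: "v \<in> Tan p \<Longrightarrow> w \<in> Tan p \<Longrightarrow> v + w \<in> Tan p"
  using Tan_combination[of v p w 1 1] by simp

lemma Tan_diff: "v \<in> Tan p \<Longrightarrow> w \<in> Tan p \<Longrightarrow> v - w \<in> Tan p"
  using Tan_combination[of v p w 1 "-1"] by simp

text \<open>The field with constant components \<open>w\<close> in the chart. The value 0 on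
  functions that are not smooth near \<open>q\<close> follows the convention for tangent vectors, so
  that it can equal a tangent vector as a functional.\<close>

definition coord_field :: "'a set \<Rightarrow> ('a \<Rightarrow> 'e) \<Rightarrow> 'e \<Rightarrow> 'a \<Rightarrow> 'a tvec"
  where "coord_field V \<phi> w q = (\<lambda>f. if near q f then frechet_derivative (f \<circ> inv_into V \<phi>) (at (\<phi> q)) w else 0)"

lemma near_has_derivative:
  assumes c: "(V, \<phi>) \<in> \<A>" "q \<in> V" and f: "near q f"
  shows "((f \<circ> inv_into V \<phi>) has_derivative frechet_derivative (f \<circ> inv_into V \<phi>) (at (\<phi> q))) (at (\<phi> q))"
proof -
  obtain U where U: "openin M U" "q \<in> U" "smooth_fun \<A> U f" using f unfolding smooth_near_def by blast
  then have "smooth_on (\<phi> ` (U \<inter> V)) (f \<circ> inv_into V \<phi>)"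
    using smooth_fun_chartD[OF c(1), of "U \<inter> V"] smooth_fun_subset by blast
  then show ?thesis using smooth_on_has_derivative U(2) c(2) by blast
qed

lemma coord_field_Tan:
  assumes c: "(V, \<phi>) \<in> \<A>" "q \<in> V"
  shows "coord_field V \<phi> w q \<in> Tan q"
  unfolding tangent_space_def
proof (intro CollectI conjI allI impI)
  fix f h a b assume fh: "near q f" "near q h"
  have q: "q \<in> topspace M" using near_topspace fh by blast
  note df = near_has_derivative[OF c fh(1)] and dh = near_has_derivative[OF c fh(2)]
  have 1: "near q (\<lambda>q. a * f q + b * h q)"
    by (intro near_add near_mult near_const q fh)
  have "((\<lambda>q. a * f q + b * h q) \<circ> inv_into V \<phi> has_derivative
      (\<lambda>w. a * frechet_derivative (f \<circ> inv_into V \<phi>) (at (\<phi> q)) w +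
        b * frechet_derivative (h \<circ> inv_into V \<phi>) (at (\<phi> q)) w)) (at (\<phi> q))"
    unfolding o_def
    by (intro has_derivative_add has_derivative_mult_right df[unfolded o_def] dh[unfolded o_def])
  from frechet_derivative_at[OF this, symmetric]
  show "coord_field V \<phi> w q (\<lambda>q. a * f q + b * h q) = a * coord_field V \<phi> w q f + b * coord_field V \<phi> w q h"
    using 1 fh by (simp add: coord_field_def)
  have 2: "near q (\<lambda>q. f q * h q)" by (intro near_mult fh)
  have "((\<lambda>q. f q * h q) \<circ> inv_into V \<phi> has_derivative
      (\<lambda>w. f q * frechet_derivative (h \<circ> inv_into V \<phi>) (at (\<phi> q)) w +
        frechet_derivative (f \<circ> inv_into V \<phi>) (at (\<phi> q)) w * h q)) (at (\<phi> q))"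
    using has_derivative_mult[OF df dh] by (simp add: o_def inv_chart[OF c])
  from frechet_derivative_at[OF this, symmetric]
  show "coord_field V \<phi> w q (\<lambda>q. f q * h q) = coord_field V \<phi> w q f * h q + f q * coord_field V \<phi> w q h"
    using 2 fh by (simp add: coord_field_def)
  assume "\<exists>U. openin M U \<and> q \<in> U \<and> (\<forall>q\<in>U. f q = h q)"
  then obtain U where U: "openin M U" "q \<in> U" "\<And>q. q \<in> U \<Longrightarrow> f q = h q" by blast
  have "(h \<circ> inv_into V \<phi> has_derivative frechet_derivative (f \<circ> inv_into V \<phi>) (at (\<phi> q))) (at (\<phi> q))"
    by (rule has_derivative_transform_within_open[OF df chart_image_Int_open[OF c(1) U(1)]])
       (use U c in \<open>auto simp: inv_chart[OF c(1)]\<close>)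
  from frechet_derivative_at[OF this]
  show "coord_field V \<phi> w q f = coord_field V \<phi> w q h"
    using fh by (simp add: coord_field_def)
qed (simp add: coord_field_def)

lemma coord_field_linear:
  assumes c: "(V, \<phi>) \<in> \<A>" "q \<in> V"
  shows "coord_field V \<phi> (a *\<^sub>R w + b *\<^sub>R w') q = a *\<^sub>R coord_field V \<phi> w q + b *\<^sub>R coord_field V \<phi> w' q"
proof (rule ext)
  fix f
  show "coord_field V \<phi> (a *\<^sub>R w + b *\<^sub>R w') q f = (a *\<^sub>R coord_field V \<phi> w q + b *\<^sub>R coord_field V \<phi> w' q) f"
  proof (cases "near q f")
    case True
    note lin = has_derivative_linear[OF near_has_derivative[OF c True]]
    show ?thesis
      using True by (simp add: coord_field_def scaleR_fun_def linear_add[OF lin] linear_scale[OF lin])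
  qed (simp add: coord_field_def scaleR_fun_def)
qed

text \<open>Coordinate functions recover the components; in particular a nonzero \<open>w\<close>
  gives a nonzero tangent vector.\<close>

lemma coord_field_coordinate:
  assumes c: "(V, \<phi>) \<in> \<A>" "q \<in> V"
  shows "coord_field V \<phi> w q (\<lambda>q. \<phi> q \<bullet> b) = w \<bullet> b"
proof -
  have "((\<lambda>x. x \<bullet> b) has_derivative (\<lambda>w. w \<bullet> b)) (at (\<phi> q))"
    by (auto intro!: derivative_eq_intros)
  then have "((\<lambda>q. \<phi> q \<bullet> b) \<circ> inv_into V \<phi> has_derivative (\<lambda>w. w \<bullet> b)) (at (\<phi> q))"
    by (rule has_derivative_transform_within_open[OF _ chart_open_range[OF c(1)]])
       (use c in \<open>auto simp: inv_chart[OF c(1)]\<close>)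
  from frechet_derivative_at[OF this, symmetric] show ?thesis
    using nearI[OF chart_openin[OF c(1)] c(2) smooth_fun_coordinate[OF c(1), of b]]
    by (simp add: coord_field_def)
qed

lemma coord_field_vfield:
  assumes c: "(V, \<phi>) \<in> \<A>"
  shows "vfield V (coord_field V \<phi> w)"
  unfolding vector_field_def
proof (intro conjI ballI allI impI)
  fix W f assume W: "openin M W" "W \<subseteq> V" and f: "smooth_fun \<A> W f"
  show "smooth_fun \<A> W (\<lambda>p. coord_field V \<phi> w p f)"
  proof (rule smooth_fun_chartI[OF c W])
    show "smooth_on (\<phi> ` W) (\<lambda>x. frechet_derivative (f \<circ> inv_into V \<phi>) (at x) w)"
      by (rule smooth_on_frechet_derivative[OF smooth_fun_chartD[OF c W(2) f]])
    show "coord_field V \<phi> w q f = frechet_derivative (f \<circ> inv_into V \<phi>) (at (\<phi> q)) w" if "q \<in> W" for q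
      using nearI[OF W(1) that f] by (simp add: coord_field_def)
  qed
qed (rule coord_field_Tan[OF c])

text \<open>Apply \<open>v\<close> to the Hadamard expansion of \<open>f\<close> at
  \<open>q\<close>. The constant term is killed, and in each product the factor
  \<open>\<phi> - \<phi> q\<close> vanishes at \<open>q\<close>, so the Leibniz rule leaves only
  \<open>v\<close> of a coordinate times a partial derivative of \<open>f\<close>.\<close>

lemma Tan_eq_coord_field:
  assumes c: "(V, \<phi>) \<in> \<A>" "q \<in> V" and v: "v \<in> Tan q"
  shows "v = coord_field V \<phi> (\<Sum>b\<in>Basis. v (\<lambda>q. \<phi> q \<bullet> b) *\<^sub>R b) q"
proof (rule ext)
  fix f
  let ?w = "\<Sum>b\<in>Basis. v (\<lambda>q. \<phi> q \<bullet> b) *\<^sub>R b"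
  show "v f = coord_field V \<phi> ?w q f"
  proof (cases "near q f")
    case False
    then show ?thesis using Tan_outside[OF v] by (simp add: coord_field_def)
  next
    case f: True
    have q: "q \<in> topspace M" using near_topspace f by blast
    obtain U where U: "openin M U" "q \<in> U" "smooth_fun \<A> U f" using f unfolding smooth_near_def by blast
    let ?F = "f \<circ> inv_into V \<phi>"
    have "\<phi> q \<in> \<phi> ` (U \<inter> V)" using U c by auto
    then obtain r where r: "r > 0" "ball (\<phi> q) r \<subseteq> \<phi> ` (U \<inter> V)"
      using chart_image_Int_open[OF c(1) U(1)] openE by blast
    have "smooth_on (\<phi> ` (U \<inter> V)) ?F"
      using smooth_fun_chartD[OF c(1), of "U \<inter> V"] smooth_fun_subset U(3) by blast
    then have "smooth_on (ball (\<phi> q) r) ?F" using r(2) smooth_on_subset by blast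
    then obtain G where G: "\<And>b. smooth_on (ball (\<phi> q) r) (G b)"
      and F: "\<And>x. x \<in> ball (\<phi> q) r \<Longrightarrow> ?F x = ?F (\<phi> q) + (\<Sum>b\<in>Basis. ((x - \<phi> q) \<bullet> b) * G b x)"
      and Gq: "\<And>b. G b (\<phi> q) = frechet_derivative ?F (at (\<phi> q)) b"
      using hadamard_lemma by blast
    \<comment> \<open>The expansion holds only over the ball. Its preimage is an open neighbourhood
      of \<open>q\<close>, and locality of derivations allows \<open>f\<close> to be replaced
      there.\<close>
    define B where "B = {p \<in> V. \<phi> p \<in> ball (\<phi> q) r}"
    have B: "openin M B" "q \<in> B" "B \<subseteq> V"
      using chart_preimage_open[OF c(1) open_ball] r c(2) by (auto simp: B_def)
    have "smooth_fun \<A> B (\<lambda>p. G b (\<phi> p))" for b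
      by (rule smooth_fun_chartI[OF c(1) B(1,3) smooth_on_subset[OF G[of b]]]) (auto simp: B_def)
    then have nG: "near q (\<lambda>p. G b (\<phi> p))" for b using nearI B by blast
    have n\<phi>: "near q (\<lambda>p. \<phi> p \<bullet> b)" for b
      by (rule nearI[OF chart_openin[OF c(1)] c(2) smooth_fun_coordinate[OF c(1)]])
    have n\<phi>': "near q (\<lambda>p. \<phi> p \<bullet> b + - (\<phi> q \<bullet> b))" for b by (intro near_add near_const n\<phi> q)
    have v\<phi>: "v (\<lambda>p. \<phi> p \<bullet> b + - (\<phi> q \<bullet> b)) = v (\<lambda>p. \<phi> p \<bullet> b)" for b
      by (simp only: Tan_add[OF v n\<phi> near_const[OF q]] Tan_const[OF v q] add_0_right)
    have n: "near q (\<lambda>p. (\<phi> p \<bullet> b + - (\<phi> q \<bullet> b)) * G b (\<phi> p))" for b by (intro near_mult nG n\<phi>')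
    have "v f = v (\<lambda>p. f q + (\<Sum>b\<in>Basis. (\<phi> p \<bullet> b + - (\<phi> q \<bullet> b)) * G b (\<phi> p)))"
    proof (rule Tan_cong[OF v f _ B(1,2)])
      show "near q (\<lambda>p. f q + (\<Sum>b\<in>Basis. (\<phi> p \<bullet> b + - (\<phi> q \<bullet> b)) * G b (\<phi> p)))"
        by (intro near_add near_const near_sum q n)
      fix p assume "p \<in> B"
      then have p: "p \<in> V" "\<phi> p \<in> ball (\<phi> q) r" by (auto simp: B_def)
      show "f p = f q + (\<Sum>b\<in>Basis. (\<phi> p \<bullet> b + - (\<phi> q \<bullet> b)) * G b (\<phi> p))"
        using F[OF p(2)] p(1) c by (simp add: inv_chart[OF c(1)] inner_diff_left)
    qed
    also have "\<dots> = (\<Sum>b\<in>Basis. v (\<lambda>p. (\<phi> p \<bullet> b + - (\<phi> q \<bullet> b)) * G b (\<phi> p)))"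
      by (simp only: Tan_add[OF v near_const[OF q] near_sum[OF q n]] Tan_const[OF v q] Tan_sum[OF v q n] add_0)
    also have "\<dots> = (\<Sum>b\<in>Basis. v (\<lambda>p. \<phi> p \<bullet> b) * frechet_derivative ?F (at (\<phi> q)) b)"
      by (simp only: Tan_mult[OF v n\<phi>' nG] v\<phi> Gq) simp
    also have "\<dots> = frechet_derivative ?F (at (\<phi> q)) ?w"
    proof -
      note lin = has_derivative_linear[OF near_has_derivative[OF c f]]
      show ?thesis by (simp add: linear_sum[OF lin] linear_scale[OF lin])
    qed
    also have "\<dots> = coord_field V \<phi> ?w q f" using f by (simp add: coord_field_def)
    finally show ?thesis .
  qed
qed

section \<open>Vector fields and operators linear over functions\<close>

lemma vfield_Tan: "vfield U X \<Longrightarrow> q \<in> U \<Longrightarrow> X q \<in> Tan q"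
  unfolding vector_field_def by blast

lemma vfield_smooth:
  "vfield U X \<Longrightarrow> openin M V \<Longrightarrow> V \<subseteq> U \<Longrightarrow> smooth_fun \<A> V f \<Longrightarrow> smooth_fun \<A> V (\<lambda>q. X q f)"
  unfolding vector_field_def by blast

lemma vfield_subset: "vfield U X \<Longrightarrow> U' \<subseteq> U \<Longrightarrow> vfield U' X"
  unfolding vector_field_def by (meson subsetD subset_trans)

lemma vfield_add:
  assumes "vfield U X" "vfield U Y"
  shows "vfield U (\<lambda>q. X q + Y q)"
  using assms unfolding vector_field_def by (auto intro: Tan_plus smooth_fun_add)

lemma vfield_mult:
  assumes "vfield U X" "smooth_fun \<A> U f"
  shows "vfield U (\<lambda>q. f q *\<^sub>R X q)"
  unfolding vector_field_def
proof (intro conjI ballI allI impI)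
  show "f q *\<^sub>R X q \<in> Tan q" if "q \<in> U" for q
    using assms(1) that unfolding vector_field_def by (blast intro: Tan_scale)
  fix V h assume V: "openin M V" "V \<subseteq> U" "smooth_fun \<A> V h"
  then have "smooth_fun \<A> V (\<lambda>q. X q h)" using assms(1) unfolding vector_field_def by blast
  then show "smooth_fun \<A> V (\<lambda>q. (f q *\<^sub>R X q) h)"
    using smooth_fun_mult[OF V(1) smooth_fun_subset[OF assms(2) V(2)]] by (simp add: scaleR_fun_def)
qed

lemma vfield_sum:
  assumes "openin M U" "finite I" "I \<noteq> {}" "\<And>i. i \<in> I \<Longrightarrow> vfield U (X i)"
  shows "vfield U (\<lambda>q. \<Sum>i\<in>I. X i q)"
  using assms(2-4) by (induction I rule: finite_ne_induct) (auto intro: vfield_add)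

lemma vfield_eq_coord:
  assumes c: "(V, \<phi>) \<in> \<A>" and U: "U \<subseteq> V" and X: "vfield U X" and q: "q \<in> U"
  shows "X q = (\<Sum>b\<in>Basis. X q (\<lambda>q. \<phi> q \<bullet> b) *\<^sub>R coord_field V \<phi> b q)"
proof -
  have qV: "q \<in> V" using U q by auto
  have "linear (\<lambda>w. coord_field V \<phi> w q)"
    using coord_field_linear[OF c qV, of 1 _ 1] coord_field_linear[OF c qV, of _ _ 0]
    by (intro linearI) auto
  from linear_sum[OF this, of "\<lambda>b. X q (\<lambda>q. \<phi> q \<bullet> b) *\<^sub>R b" Basis] linear_scale[OF this]
  show ?thesis
    using Tan_eq_coord_field[OF c qV vfield_Tan[OF X q]] by simp
qed

text \<open>The tensoriality principle: the right side involves \<open>X\<close> only through its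
  value at \<open>p\<close>. As \<open>U\<close> lies in one chart, the coordinate fields form a
  frame on all of \<open>U\<close>, and the coefficient functions can be pulled out of
  \<open>\<Phi>\<close>. The assumption \<open>cong\<close> reflects that fields are total functions
  of which only the restriction to \<open>U\<close> has a meaning.\<close>

lemma tensorial_expansion:
  fixes \<Phi> :: "('a \<Rightarrow> 'a tvec) \<Rightarrow> 'b::real_vector"
  assumes c: "(V, \<phi>) \<in> \<A>" and U: "openin M U" "U \<subseteq> V" and p: "p \<in> U"
    and add: "\<And>X Y. vfield U X \<Longrightarrow> vfield U Y \<Longrightarrow> \<Phi> (\<lambda>q. X q + Y q) = \<Phi> X + \<Phi> Y"
    and mult: "\<And>X f. vfield U X \<Longrightarrow> smooth_fun \<A> U f \<Longrightarrow> \<Phi> (\<lambda>q. f q *\<^sub>R X q) = f p *\<^sub>R \<Phi> X"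
    and cong: "\<And>X Y. vfield U X \<Longrightarrow> vfield U Y \<Longrightarrow> (\<And>q. q \<in> U \<Longrightarrow> X q = Y q) \<Longrightarrow> \<Phi> X = \<Phi> Y"
    and X: "vfield U X"
  shows "\<Phi> X = (\<Sum>b\<in>Basis. X p (\<lambda>q. \<phi> q \<bullet> b) *\<^sub>R \<Phi> (coord_field V \<phi> b))"
proof -
  let ?E = "\<lambda>b. coord_field V \<phi> b"
  have E: "vfield U (?E b)" for b using vfield_subset[OF coord_field_vfield[OF c] U(2)] .
  have f: "smooth_fun \<A> U (\<lambda>q. X q (\<lambda>q. \<phi> q \<bullet> b))" for b
    using vfield_smooth[OF X U(1) order_refl] smooth_fun_subset[OF smooth_fun_coordinate[OF c] U(2)] by blast
  \<comment> \<open>The induction starts from singletons, so the value of \<open>\<Phi>\<close> at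
    the zero field never comes up.\<close>
  have sum: "\<Phi> (\<lambda>q. \<Sum>i\<in>I. Y i q) = (\<Sum>i\<in>I. \<Phi> (Y i))"
    if "finite I" "I \<noteq> {}" "\<And>i. i \<in> I \<Longrightarrow> vfield U (Y i)" for I :: "'e set" and Y
    using that
  proof (induction I rule: finite_ne_induct)
    case (insert x F)
    have "\<Phi> (\<lambda>q. Y x q + (\<Sum>i\<in>F. Y i q)) = \<Phi> (Y x) + \<Phi> (\<lambda>q. \<Sum>i\<in>F. Y i q)"
      by (rule add) (use insert in \<open>auto intro: vfield_sum[OF U(1)]\<close>)
    also have "\<Phi> (\<lambda>q. \<Sum>i\<in>F. Y i q) = (\<Sum>i\<in>F. \<Phi> (Y i))"
      using insert.prems by (intro insert.IH) blast
    finally show ?case by (simp only: sum.insert[OF insert.hyps(1,3)])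
  qed simp
  have fE: "vfield U (\<lambda>q. X q (\<lambda>q. \<phi> q \<bullet> b) *\<^sub>R ?E b q)" for b by (rule vfield_mult[OF E f])
  have "\<Phi> X = \<Phi> (\<lambda>q. \<Sum>b\<in>Basis. X q (\<lambda>q. \<phi> q \<bullet> b) *\<^sub>R ?E b q)"
    by (rule cong[OF X vfield_sum[OF U(1) finite_Basis _ fE]]) (auto intro: vfield_eq_coord[OF c U(2) X])
  also have "\<dots> = (\<Sum>b\<in>Basis. X p (\<lambda>q. \<phi> q \<bullet> b) *\<^sub>R \<Phi> (?E b))"
    using sum[OF finite_Basis _ fE] mult[OF E f] by simp
  finally show ?thesis .
qed

end

section \<open>Tensoriality and symmetries of the curvature\<close>

locale levi_civita_manifold = atlas_manifold M \<A>
  for M :: "'a topology" and \<A> :: "('a, 'e::euclidean_space) chart set" +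
  fixes g :: "'a \<Rightarrow> 'a tvec \<Rightarrow> 'a tvec \<Rightarrow> real"
    and D :: "'a \<Rightarrow> 'a tvec \<Rightarrow> ('a \<Rightarrow> 'a tvec) \<Rightarrow> 'a tvec"
  assumes riemannian: "riemannian_metric M \<A> g"
    and levi_civita: "levi_civita_connection M \<A> g D"
begin

section \<open>Rules for the metric and the connection\<close>

lemma g_linear:
  "p \<in> topspace M \<Longrightarrow> u \<in> Tan p \<Longrightarrow> v \<in> Tan p \<Longrightarrow> w \<in> Tan p \<Longrightarrow>
    g p w (a *\<^sub>R u + c *\<^sub>R v) = a * g p w u + c * g p w v"
  using riemannian unfolding riemannian_metric_def linear_between_def by simp

lemma g_commute: "p \<in> topspace M \<Longrightarrow> v \<in> Tan p \<Longrightarrow> w \<in> Tan p \<Longrightarrow> g p v w = g p w v"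
  using riemannian unfolding riemannian_metric_def by blast

lemma g_pos: "p \<in> topspace M \<Longrightarrow> v \<in> Tan p \<Longrightarrow> v \<noteq> 0 \<Longrightarrow> g p v v > 0"
  using riemannian unfolding riemannian_metric_def by blast

lemma g_smooth:
  "openin M U \<Longrightarrow> vfield U X \<Longrightarrow> vfield U Y \<Longrightarrow> smooth_fun \<A> U (\<lambda>p. g p (X p) (Y p))"
  by (rule riemannian[unfolded riemannian_metric_def, THEN conjunct2, rule_format])

lemma g_linear_left:
  "p \<in> topspace M \<Longrightarrow> u \<in> Tan p \<Longrightarrow> v \<in> Tan p \<Longrightarrow> w \<in> Tan p \<Longrightarrow>
    g p (a *\<^sub>R u + c *\<^sub>R v) w = a * g p u w + c * g p v w"
  using g_linear[of p u v w a c] g_commute Tan_combination by simp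

lemma connection:
  assumes "openin M U" "vfield U Y"
  shows "\<forall>p\<in>U. linear_between (Tan p) (Tan p) (\<lambda>v. D p v Y)"
    and "\<forall>X. vfield U X \<longrightarrow> vfield U (\<lambda>p. D p (X p) Y)"
    and "\<forall>Z. vfield U Z \<longrightarrow> (\<forall>p\<in>U. \<forall>v\<in>Tan p.
          D p v (\<lambda>q. Y q + Z q) = D p v Y + D p v Z \<and>
          ((\<forall>q\<in>U. Y q = Z q) \<longrightarrow> D p v Y = D p v Z))"
    and "\<forall>f. smooth_fun \<A> U f \<longrightarrow> (\<forall>p\<in>U. \<forall>v\<in>Tan p.
          D p v (\<lambda>q. f q *\<^sub>R Y q) = v f *\<^sub>R Y p + f p *\<^sub>R D p v Y)"
proof -
  note conn = levi_civita[unfolded levi_civita_connection_def, THEN conjunct1,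
      unfolded affine_connection_def, rule_format, OF assms]
  show "\<forall>p\<in>U. linear_between (Tan p) (Tan p) (\<lambda>v. D p v Y)"
    by (rule conn[THEN conjunct1])
  show "\<forall>X. vfield U X \<longrightarrow> vfield U (\<lambda>p. D p (X p) Y)"
    by (rule conn[THEN conjunct2, THEN conjunct1])
  show "\<forall>Z. vfield U Z \<longrightarrow> (\<forall>p\<in>U. \<forall>v\<in>Tan p.
          D p v (\<lambda>q. Y q + Z q) = D p v Y + D p v Z \<and>
          ((\<forall>q\<in>U. Y q = Z q) \<longrightarrow> D p v Y = D p v Z))"
    by (rule conn[THEN conjunct2, THEN conjunct2, THEN conjunct1])
  show "\<forall>f. smooth_fun \<A> U f \<longrightarrow> (\<forall>p\<in>U. \<forall>v\<in>Tan p.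
          D p v (\<lambda>q. f q *\<^sub>R Y q) = v f *\<^sub>R Y p + f p *\<^sub>R D p v Y)"
    by (rule conn[THEN conjunct2, THEN conjunct2, THEN conjunct2])
qed

lemma D_Tan:
  "openin M U \<Longrightarrow> vfield U Y \<Longrightarrow> p \<in> U \<Longrightarrow> v \<in> Tan p \<Longrightarrow> D p v Y \<in> Tan p"
  by (drule (1) connection(1)) (simp add: linear_between_def image_subset_iff)

lemma D_linear:
  "openin M U \<Longrightarrow> vfield U Y \<Longrightarrow> p \<in> U \<Longrightarrow> v \<in> Tan p \<Longrightarrow> w \<in> Tan p \<Longrightarrow>
    D p (a *\<^sub>R v + c *\<^sub>R w) Y = a *\<^sub>R D p v Y + c *\<^sub>R D p w Y"
  by (drule (1) connection(1)) (simp add: linear_between_def)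

lemma D_vfield:
  "openin M U \<Longrightarrow> vfield U Y \<Longrightarrow> vfield U X \<Longrightarrow> vfield U (\<lambda>p. D p (X p) Y)"
  by (rule connection(2)[rule_format])

lemma D_add:
  "openin M U \<Longrightarrow> vfield U Y \<Longrightarrow> vfield U Z \<Longrightarrow> p \<in> U \<Longrightarrow> v \<in> Tan p \<Longrightarrow>
    D p v (\<lambda>q. Y q + Z q) = D p v Y + D p v Z"
  by (rule connection(3)[rule_format, THEN conjunct1])

lemma D_cong:
  "openin M U \<Longrightarrow> vfield U Y \<Longrightarrow> vfield U Z \<Longrightarrow> p \<in> U \<Longrightarrow> v \<in> Tan p \<Longrightarrow>
    (\<And>q. q \<in> U \<Longrightarrow> Y q = Z q) \<Longrightarrow> D p v Y = D p v Z"
  by (rule connection(3)[rule_format, THEN conjunct2, rule_format])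

lemma D_mult:
  "openin M U \<Longrightarrow> vfield U Y \<Longrightarrow> smooth_fun \<A> U f \<Longrightarrow> p \<in> U \<Longrightarrow> v \<in> Tan p \<Longrightarrow>
    D p v (\<lambda>q. f q *\<^sub>R Y q) = v f *\<^sub>R Y p + f p *\<^sub>R D p v Y"
  by (rule connection(4)[rule_format])

lemma torsion_free:
  "openin M U \<Longrightarrow> vfield U X \<Longrightarrow> vfield U Y \<Longrightarrow> p \<in> U \<Longrightarrow>
    lie_bracket M \<A> X Y p = D p (X p) Y - D p (Y p) X"
  by (rule levi_civita[unfolded levi_civita_connection_def, THEN conjunct2, THEN conjunct1,
        rule_format, symmetric])

lemma metric_compatible:
  "openin M U \<Longrightarrow> vfield U Y \<Longrightarrow> vfield U Z \<Longrightarrow> p \<in> U \<Longrightarrow> v \<in> Tan p \<Longrightarrow>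
    v (\<lambda>q. g q (Y q) (Z q)) = g p (D p v Y) (Z p) + g p (Y p) (D p v Z)"
  by (rule levi_civita[unfolded levi_civita_connection_def, THEN conjunct2, THEN conjunct2, rule_format])

lemma D_plus:
  "openin M U \<Longrightarrow> vfield U Y \<Longrightarrow> p \<in> U \<Longrightarrow> v \<in> Tan p \<Longrightarrow> w \<in> Tan p \<Longrightarrow> D p (v + w) Y = D p v Y + D p w Y"
  using D_linear[of U Y p v w 1 1] by simp

lemma D_scale:
  "openin M U \<Longrightarrow> vfield U Y \<Longrightarrow> p \<in> U \<Longrightarrow> v \<in> Tan p \<Longrightarrow> D p (a *\<^sub>R v) Y = a *\<^sub>R D p v Y"
  using D_linear[of U Y p v v a 0] by simp

text \<open>Torsion-freeness spares the verification that the bracket is a derivation.\<close>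

lemma bracket_Tan:
  "openin M U \<Longrightarrow> vfield U X \<Longrightarrow> vfield U Y \<Longrightarrow> p \<in> U \<Longrightarrow> lie_bracket M \<A> X Y p \<in> Tan p"
  using torsion_free D_Tan Tan_diff vfield_Tan by metis

abbreviation "Rop \<equiv> curvature_operator M \<A> D"

section \<open>The curvature operator on local vector fields\<close>

context
  fixes U p
  assumes U: "openin M U" and p: "p \<in> U"
begin

lemma p_topspace: "p \<in> topspace M"
  using U p openin_subset by blast

lemma Rop_Tan:
  assumes "vfield U X" "vfield U Y" "vfield U Z"
  shows "Rop X Y Z p \<in> Tan p"
  unfolding curvature_operator_def
  by (intro Tan_diff D_Tan[OF U _ p] D_vfield[OF U] vfield_Tan[OF _ p] bracket_Tan[OF U _ _ p] assms)

lemma Rop_skew: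
  assumes "vfield U X" "vfield U Y" "vfield U Z"
  shows "Rop X Y Z p = - Rop Y X Z p"
proof -
  have "lie_bracket M \<A> X Y p = (-1) *\<^sub>R lie_bracket M \<A> Y X p"
    using torsion_free[OF U _ _ p] assms by simp
  then have "D p (lie_bracket M \<A> X Y p) Z = - D p (lie_bracket M \<A> Y X p) Z"
    using D_scale[OF U assms(3) p bracket_Tan[OF U assms(2,1) p], of "-1"] by simp
  then show ?thesis unfolding curvature_operator_def by simp
qed

lemma Rop_cong1:
  assumes "vfield U X" "vfield U X'" "vfield U Y" "vfield U Z" and eq: "\<And>q. q \<in> U \<Longrightarrow> X q = X' q"
  shows "Rop X Y Z p = Rop X' Y Z p"
proof -
  have "D p (Y p) (\<lambda>q. D q (X q) Z) = D p (Y p) (\<lambda>q. D q (X' q) Z)"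
    by (rule D_cong[OF U _ _ p vfield_Tan[OF assms(3) p]]) (auto intro: D_vfield[OF U] assms simp: eq)
  moreover have "D p (Y p) X = D p (Y p) X'"
    by (rule D_cong[OF U assms(1,2) p vfield_Tan[OF assms(3) p] eq])
  ultimately show ?thesis
    unfolding curvature_operator_def using torsion_free[OF U _ assms(3) p] assms(1,2) eq[OF p] by simp
qed

lemma Rop_add1:
  assumes X: "vfield U X" and X': "vfield U X'" and Y: "vfield U Y" and Z: "vfield U Z"
  shows "Rop (\<lambda>q. X q + X' q) Y Z p = Rop X Y Z p + Rop X' Y Z p"
proof -
  note Yp = vfield_Tan[OF Y p]
  note XX' = vfield_add[OF X X']
  have "D p (Y p) (\<lambda>q. D q (X q + X' q) Z) = D p (Y p) (\<lambda>q. D q (X q) Z + D q (X' q) Z)"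
    by (rule D_cong[OF U D_vfield[OF U Z XX'] vfield_add[OF D_vfield[OF U Z X] D_vfield[OF U Z X']] p Yp])
       (rule D_plus[OF U Z _ vfield_Tan[OF X] vfield_Tan[OF X']])
  also have "\<dots> = D p (Y p) (\<lambda>q. D q (X q) Z) + D p (Y p) (\<lambda>q. D q (X' q) Z)"
    by (rule D_add[OF U D_vfield[OF U Z X] D_vfield[OF U Z X'] p Yp])
  finally have 1: "D p (Y p) (\<lambda>q. D q (X q + X' q) Z) =
      D p (Y p) (\<lambda>q. D q (X q) Z) + D p (Y p) (\<lambda>q. D q (X' q) Z)" .
  have 2: "D p (X p + X' p) (\<lambda>q. D q (Y q) Z) = D p (X p) (\<lambda>q. D q (Y q) Z) + D p (X' p) (\<lambda>q. D q (Y q) Z)"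
    by (rule D_plus[OF U D_vfield[OF U Z Y] p vfield_Tan[OF X p] vfield_Tan[OF X' p]])
  have "lie_bracket M \<A> (\<lambda>q. X q + X' q) Y p = lie_bracket M \<A> X Y p + lie_bracket M \<A> X' Y p"
    using torsion_free[OF U XX' Y p] torsion_free[OF U X Y p] torsion_free[OF U X' Y p]
      D_plus[OF U Y p vfield_Tan[OF X p] vfield_Tan[OF X' p]] D_add[OF U X X' p Yp] by simp
  then have 3: "D p (lie_bracket M \<A> (\<lambda>q. X q + X' q) Y p) Z =
      D p (lie_bracket M \<A> X Y p) Z + D p (lie_bracket M \<A> X' Y p) Z"
    using D_plus[OF U Z p bracket_Tan[OF U X Y p] bracket_Tan[OF U X' Y p]] by simp
  show ?thesis unfolding curvature_operator_def 1 2 3 by simp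
qed

text \<open>The derivative of \<open>f\<close> produced by the second covariant derivative is
  \<open>(Y f) D_X Z\<close>. It cancels against the bracket term, because
  \<open>[f X, Y] = f [X, Y] - (Y f) X\<close>.\<close>

lemma Rop_mult1:
  assumes X: "vfield U X" and f: "smooth_fun \<A> U f" and Y: "vfield U Y" and Z: "vfield U Z"
  shows "Rop (\<lambda>q. f q *\<^sub>R X q) Y Z p = f p *\<^sub>R Rop X Y Z p"
proof -
  note Xp = vfield_Tan[OF X p] and Yp = vfield_Tan[OF Y p]
  note fX = vfield_mult[OF X f]
  note DXZ = D_vfield[OF U Z X]
  have "D p (Y p) (\<lambda>q. D q (f q *\<^sub>R X q) Z) = D p (Y p) (\<lambda>q. f q *\<^sub>R D q (X q) Z)"
    by (rule D_cong[OF U D_vfield[OF U Z fX] vfield_mult[OF DXZ f] p Yp])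
       (rule D_scale[OF U Z _ vfield_Tan[OF X]])
  also have "\<dots> = Y p f *\<^sub>R D p (X p) Z + f p *\<^sub>R D p (Y p) (\<lambda>q. D q (X q) Z)"
    by (rule D_mult[OF U DXZ f p Yp])
  finally have 1: "D p (Y p) (\<lambda>q. D q (f q *\<^sub>R X q) Z) =
      Y p f *\<^sub>R D p (X p) Z + f p *\<^sub>R D p (Y p) (\<lambda>q. D q (X q) Z)" .
  have 2: "D p (f p *\<^sub>R X p) (\<lambda>q. D q (Y q) Z) = f p *\<^sub>R D p (X p) (\<lambda>q. D q (Y q) Z)"
    by (rule D_scale[OF U D_vfield[OF U Z Y] p Xp])
  have "lie_bracket M \<A> (\<lambda>q. f q *\<^sub>R X q) Y p = f p *\<^sub>R lie_bracket M \<A> X Y p + (- Y p f) *\<^sub>R X p"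
    unfolding torsion_free[OF U fX Y p] torsion_free[OF U X Y p] D_scale[OF U Y p Xp] D_mult[OF U X f p Yp]
    by (simp add: algebra_simps)
  then have 3: "D p (lie_bracket M \<A> (\<lambda>q. f q *\<^sub>R X q) Y p) Z =
      f p *\<^sub>R D p (lie_bracket M \<A> X Y p) Z + (- Y p f) *\<^sub>R D p (X p) Z"
    by (simp only: D_linear[OF U Z p bracket_Tan[OF U X Y p] Xp])
  show ?thesis unfolding curvature_operator_def 1 2 3 by (simp add: algebra_simps)
qed

lemma Rop_cong3:
  assumes X: "vfield U X" and Y: "vfield U Y" and Z: "vfield U Z" and Z': "vfield U Z'"
    and eq: "\<And>q. q \<in> U \<Longrightarrow> Z q = Z' q"
  shows "Rop X Y Z p = Rop X Y Z' p"
proof -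
  have 1: "D q v Z = D q v Z'" if "q \<in> U" "v \<in> Tan q" for q v
    by (rule D_cong[OF U Z Z' that eq])
  have 2: "D p v (\<lambda>q. D q (W q) Z) = D p v (\<lambda>q. D q (W q) Z')" if "vfield U W" "v \<in> Tan p" for v W
    by (rule D_cong[OF U D_vfield[OF U Z that(1)] D_vfield[OF U Z' that(1)] p that(2)])
       (rule 1[OF _ vfield_Tan[OF that(1)]])
  show ?thesis
    unfolding curvature_operator_def 1[OF p bracket_Tan[OF U X Y p]]
      2[OF Y vfield_Tan[OF X p]] 2[OF X vfield_Tan[OF Y p]] ..
qed

lemma Rop_add3:
  assumes X: "vfield U X" and Y: "vfield U Y" and Z: "vfield U Z" and Z': "vfield U Z'"
  shows "Rop X Y (\<lambda>q. Z q + Z' q) p = Rop X Y Z p + Rop X Y Z' p"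
proof -
  have 1: "D q v (\<lambda>q. Z q + Z' q) = D q v Z + D q v Z'" if "q \<in> U" "v \<in> Tan q" for q v
    by (rule D_add[OF U Z Z' that])
  have 2: "D p v (\<lambda>q. D q (W q) (\<lambda>q. Z q + Z' q)) = D p v (\<lambda>q. D q (W q) Z) + D p v (\<lambda>q. D q (W q) Z')"
    if W: "vfield U W" and v: "v \<in> Tan p" for v W
  proof -
    note DZ = D_vfield[OF U Z W] and DZ' = D_vfield[OF U Z' W]
    have "D p v (\<lambda>q. D q (W q) (\<lambda>q. Z q + Z' q)) = D p v (\<lambda>q. D q (W q) Z + D q (W q) Z')"
      by (rule D_cong[OF U D_vfield[OF U vfield_add[OF Z Z'] W] vfield_add[OF DZ DZ'] p v])
         (rule 1[OF _ vfield_Tan[OF W]])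
    then show ?thesis using D_add[OF U DZ DZ' p v] by simp
  qed
  show ?thesis
    unfolding curvature_operator_def 1[OF p bracket_Tan[OF U X Y p]]
      2[OF Y vfield_Tan[OF X p]] 2[OF X vfield_Tan[OF Y p]] by simp
qed

lemma bracket_apply:
  assumes "near p f"
  shows "lie_bracket M \<A> X Y p f = X p (\<lambda>q. Y q f) - Y p (\<lambda>q. X q f)"
  using assms by (simp add: lie_bracket_def)

text \<open>The mixed terms with one derivative of \<open>f\<close> are symmetric in
  \<open>X\<close> and \<open>Y\<close> and cancel. The second-order terms combine to
  \<open>X (Y f) - Y (X f) - [X, Y] f\<close>, which is 0 by the definition of the bracket.\<close>

lemma Rop_mult3:
  assumes X: "vfield U X" and Y: "vfield U Y" and Z: "vfield U Z" and f: "smooth_fun \<A> U f"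
  shows "Rop X Y (\<lambda>q. f q *\<^sub>R Z q) p = f p *\<^sub>R Rop X Y Z p"
proof -
  have 1: "D q v (\<lambda>q. f q *\<^sub>R Z q) = v f *\<^sub>R Z q + f q *\<^sub>R D q v Z" if "q \<in> U" "v \<in> Tan q" for q v
    by (rule D_mult[OF U Z f that])
  have 2: "D p v (\<lambda>q. D q (W q) (\<lambda>q. f q *\<^sub>R Z q)) =
      v (\<lambda>q. W q f) *\<^sub>R Z p + W p f *\<^sub>R D p v Z + (v f *\<^sub>R D p (W p) Z + f p *\<^sub>R D p v (\<lambda>q. D q (W q) Z))"
    if W: "vfield U W" and v: "v \<in> Tan p" for v W
  proof -
    note DZ = D_vfield[OF U Z W] and Wf = vfield_smooth[OF W U order_refl f]
    note WfZ = vfield_mult[OF Z Wf] and fDZ = vfield_mult[OF DZ f]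
    have "D p v (\<lambda>q. D q (W q) (\<lambda>q. f q *\<^sub>R Z q)) = D p v (\<lambda>q. W q f *\<^sub>R Z q + f q *\<^sub>R D q (W q) Z)"
      by (rule D_cong[OF U D_vfield[OF U vfield_mult[OF Z f] W] vfield_add[OF WfZ fDZ] p v])
         (rule 1[OF _ vfield_Tan[OF W]])
    then show ?thesis
      unfolding D_add[OF U WfZ fDZ p v] D_mult[OF U Z Wf p v] D_mult[OF U DZ f p v] .
  qed
  show ?thesis
    unfolding curvature_operator_def 1[OF p bracket_Tan[OF U X Y p]]
      2[OF Y vfield_Tan[OF X p]] 2[OF X vfield_Tan[OF Y p]] bracket_apply[OF nearI[OF U p f]]
    by (simp add: algebra_simps)
qed

text \<open>Let \<open>G\<close> be the squared length of \<open>Z\<close>. Metric compatibility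
  turns \<open>X (Y G) - Y (X G) = [X, Y] G\<close> into the claim: each first derivative is
  \<open>2 g(D_v Z, Z)\<close>, and the products \<open>g(D_X Z, D_Y Z)\<close> cancel by symmetry
  of \<open>g\<close>.\<close>

lemma Rop_metric_skew:
  assumes X: "vfield U X" and Y: "vfield U Y" and Z: "vfield U Z"
  shows "g p (Rop X Y Z p) (Z p) = 0"
proof -
  define G where "G = (\<lambda>q. g q (Z q) (Z q))"
  have G: "smooth_fun \<A> U G" unfolding G_def by (rule g_smooth[OF U Z Z])
  note pM = p_topspace
  have UM: "q \<in> topspace M" if "q \<in> U" for q using that U openin_subset by blast
  have 1: "v G = 2 * g q (D q v Z) (Z q)" if "q \<in> U" "v \<in> Tan q" for q v
    using metric_compatible[OF U Z Z that] g_commute[OF UM[OF that(1)] D_Tan[OF U Z that] vfield_Tan[OF Z that(1)]]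
    by (simp add: G_def)
  have 2: "v (\<lambda>q. W q G) = 2 * (g p (D p v (\<lambda>q. D q (W q) Z)) (Z p) + g p (D p (W p) Z) (D p v Z))"
    if W: "vfield U W" and v: "v \<in> Tan p" for v W
  proof -
    note DZ = D_vfield[OF U Z W]
    have n: "near p (\<lambda>q. g q (D q (W q) Z) (Z q))" by (rule nearI[OF U p g_smooth[OF U DZ Z]])
    have "v (\<lambda>q. W q G) = v (\<lambda>q. 2 * g q (D q (W q) Z) (Z q))"
      by (rule Tan_cong[OF v nearI[OF U p vfield_smooth[OF W U order_refl G]] near_mult[OF near_const[OF pM] n] U p])
         (rule 1[OF _ vfield_Tan[OF W]])
    also have "\<dots> = 2 * v (\<lambda>q. g q (D q (W q) Z) (Z q))" by (rule Tan_cmult[OF v n])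
    finally show ?thesis using metric_compatible[OF U DZ Z p v] by simp
  qed
  have lin: "g p (u - v) (Z p) = g p u (Z p) - g p v (Z p)" if "u \<in> Tan p" "v \<in> Tan p" for u v
    using g_linear_left[OF pM that vfield_Tan[OF Z p], of 1 "-1"] by simp
  note Xp = vfield_Tan[OF X p] and Yp = vfield_Tan[OF Y p] and DXZ = D_vfield[OF U Z X] and DYZ = D_vfield[OF U Z Y]
  note Tans = D_Tan[OF U DYZ p Xp] D_Tan[OF U DXZ p Yp] D_Tan[OF U Z p bracket_Tan[OF U X Y p]]
  have "2 * g p (D p (lie_bracket M \<A> X Y p) Z) (Z p) = X p (\<lambda>q. Y q G) - Y p (\<lambda>q. X q G)"
    using 1[OF p bracket_Tan[OF U X Y p]] bracket_apply[OF nearI[OF U p G]] by simp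
  also have "\<dots> = 2 * (g p (D p (X p) (\<lambda>q. D q (Y q) Z)) (Z p) - g p (D p (Y p) (\<lambda>q. D q (X q) Z)) (Z p))"
    using 2[OF Y Xp] 2[OF X Yp] g_commute[OF pM D_Tan[OF U Z p Xp] D_Tan[OF U Z p Yp]] by simp
  finally show ?thesis
    unfolding curvature_operator_def using Tans by (simp add: lin Tan_diff)
qed

end

text \<open>After restriction to a chart around \<open>p\<close>, tensoriality handles the first and
  third arguments; the second is exchanged with the first by skew symmetry and back.\<close>

lemma Rop_pointwise:
  assumes U: "openin M U" and p: "p \<in> U"
    and vf: "vfield U X" "vfield U Y" "vfield U Z" "vfield U X'" "vfield U Y'" "vfield U Z'"
    and eq: "X p = X' p" "Y p = Y' p" "Z p = Z' p"
  shows "Rop X Y Z p = Rop X' Y' Z' p"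
proof -
  obtain V \<phi> where c: "(V, \<phi>) \<in> \<A>" "p \<in> V"
    using chart_cover p_topspace[OF U p] by blast
  define W where "W = U \<inter> V"
  have W: "openin M W" "W \<subseteq> V" "p \<in> W"
    using U p c chart_openin by (auto simp: W_def)
  have vfW: "vfield W X" "vfield W Y" "vfield W Z" "vfield W X'" "vfield W Y'" "vfield W Z'"
    using vf vfield_subset by (auto simp: W_def)
  have X: "Rop A B C p = Rop A' B C p"
    if "vfield W A" "vfield W A'" "vfield W B" "vfield W C" "A p = A' p" for A A' B C
  proof -
    have "Rop E B C p = (\<Sum>b\<in>Basis. E p (\<lambda>q. \<phi> q \<bullet> b) *\<^sub>R Rop (coord_field V \<phi> b) B C p)"
      if E: "vfield W E" for E
      using W(1,3) \<open>vfield W B\<close> \<open>vfield W C\<close>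
      by (intro tensorial_expansion[where \<Phi> = "\<lambda>E. Rop E B C p", OF c(1) W(1,2,3) _ _ _ E]
          Rop_add1 Rop_mult1 Rop_cong1)
    then show ?thesis using that by simp
  qed
  have Z: "Rop A B C p = Rop A B C' p"
    if "vfield W A" "vfield W B" "vfield W C" "vfield W C'" "C p = C' p" for A B C C'
  proof -
    have "Rop A B E p = (\<Sum>b\<in>Basis. E p (\<lambda>q. \<phi> q \<bullet> b) *\<^sub>R Rop A B (coord_field V \<phi> b) p)"
      if E: "vfield W E" for E
      using W(1,3) \<open>vfield W A\<close> \<open>vfield W B\<close>
      by (intro tensorial_expansion[where \<Phi> = "\<lambda>E. Rop A B E p", OF c(1) W(1,2,3) _ _ _ E]
          Rop_add3 Rop_mult3 Rop_cong3)
    then show ?thesis using that by simp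
  qed
  have "Rop X Y Z p = Rop X' Y Z p" using X vfW eq by blast
  also have "\<dots> = - Rop Y X' Z p" using Rop_skew W vfW by blast
  also have "\<dots> = - Rop Y' X' Z p" using X[of Y Y' X' Z] vfW eq by simp
  also have "\<dots> = Rop X' Y' Z p" using Rop_skew W vfW by (metis minus_minus)
  also have "\<dots> = Rop X' Y' Z' p" using Z vfW eq by blast
  finally show ?thesis .
qed

text \<open>Resolves the definite description. Competing extensions may live on different open sets,
  so they are compared on the intersection.\<close>

lemma curvature_at_eq:
  assumes U: "openin M U" and p: "p \<in> U" and vf: "vfield U X" "vfield U Y" "vfield U Z"
  shows "curvature_at M \<A> D p (X p) (Y p) (Z p) = Rop X Y Z p"
  unfolding curvature_at_def
proof (rule the_equality)
  show "\<exists>U' X' Y' Z'. openin M U' \<and> p \<in> U' \<and> vfield U' X' \<and> vfield U' Y' \<and> vfield U' Z' \<and>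
      X' p = X p \<and> Y' p = Y p \<and> Z' p = Z p \<and> Rop X Y Z p = Rop X' Y' Z' p"
    using assms by blast
next
  fix w
  assume "\<exists>U' X' Y' Z'. openin M U' \<and> p \<in> U' \<and> vfield U' X' \<and> vfield U' Y' \<and> vfield U' Z' \<and>
      X' p = X p \<and> Y' p = Y p \<and> Z' p = Z p \<and> w = Rop X' Y' Z' p"
  then obtain U' X' Y' Z' where U': "openin M U'" "p \<in> U'" and vf': "vfield U' X'" "vfield U' Y'" "vfield U' Z'"
    and eq: "X' p = X p" "Y' p = Y p" "Z' p = Z p" and w: "w = Rop X' Y' Z' p" by blast
  show "w = Rop X Y Z p"
    unfolding w
    by (rule Rop_pointwise[of "U \<inter> U'"])
       (use U p U' eq vf vf' in \<open>auto intro: openin_Int vfield_subset\<close>)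
qed

lemma curvature_at_coord_field:
  assumes c: "(V, \<phi>) \<in> \<A>" "p \<in> V"
  defines "E \<equiv> \<lambda>w. coord_field V \<phi> w"
  shows "curvature_at M \<A> D p (E u p) (E v p) (E w p) = Rop (E u) (E v) (E w) p"
  unfolding E_def by (rule curvature_at_eq[OF chart_openin[OF c(1)] c(2)]) (rule coord_field_vfield[OF c(1)])+

text \<open>Linearity of \<open>w \<mapsto> coord_field V \<phi> w\<close> holds only on
  \<open>V\<close>, so a congruence step precedes additivity and homogeneity over constant
  functions.\<close>

lemma Rop_coord_linear:
  assumes c: "(V, \<phi>) \<in> \<A>" "p \<in> V"
  defines "E \<equiv> \<lambda>w. coord_field V \<phi> w"
  shows "Rop (E (a *\<^sub>R u + b *\<^sub>R v)) (E x) (E y) p = a *\<^sub>R Rop (E u) (E x) (E y) p + b *\<^sub>R Rop (E v) (E x) (E y) p"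
    and "Rop (E x) (E y) (E (a *\<^sub>R u + b *\<^sub>R v)) p = a *\<^sub>R Rop (E x) (E y) (E u) p + b *\<^sub>R Rop (E x) (E y) (E v) p"
proof -
  note V = chart_openin[OF c(1)]
  have vf: "vfield V (E w)" for w unfolding E_def by (rule coord_field_vfield[OF c(1)])
  have sm: "vfield V (\<lambda>q. a *\<^sub>R E w q)" for a w by (rule vfield_mult[OF vf smooth_fun_const[OF V]])
  have eq: "E (a *\<^sub>R u + b *\<^sub>R v) q = a *\<^sub>R E u q + b *\<^sub>R E v q" if "q \<in> V" for q
    unfolding E_def by (rule coord_field_linear[OF c(1) that])
  have "Rop (E (a *\<^sub>R u + b *\<^sub>R v)) (E x) (E y) p = Rop (\<lambda>q. a *\<^sub>R E u q + b *\<^sub>R E v q) (E x) (E y) p"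
    by (rule Rop_cong1[OF V c(2) vf vfield_add[OF sm sm] vf vf eq])
  then show "Rop (E (a *\<^sub>R u + b *\<^sub>R v)) (E x) (E y) p = a *\<^sub>R Rop (E u) (E x) (E y) p + b *\<^sub>R Rop (E v) (E x) (E y) p"
    unfolding Rop_add1[OF V c(2) sm sm vf vf] Rop_mult1[OF V c(2) vf smooth_fun_const[OF V] vf vf] .
  have "Rop (E x) (E y) (E (a *\<^sub>R u + b *\<^sub>R v)) p = Rop (E x) (E y) (\<lambda>q. a *\<^sub>R E u q + b *\<^sub>R E v q) p"
    by (rule Rop_cong3[OF V c(2) vf vf vf vfield_add[OF sm sm] eq])
  then show "Rop (E x) (E y) (E (a *\<^sub>R u + b *\<^sub>R v)) p = a *\<^sub>R Rop (E x) (E y) (E u) p + b *\<^sub>R Rop (E x) (E y) (E v) p"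
    unfolding Rop_add3[OF V c(2) vf vf sm sm] Rop_mult3[OF V c(2) vf vf vf smooth_fun_const[OF V]] .
qed

section \<open>The curvature tensor at a point\<close>

context
  fixes p
  assumes p: "p \<in> topspace M"
begin

abbreviation "Rat \<equiv> curvature_at M \<A> D p"

text \<open>Every tangent vector at \<open>p\<close> extends to a coordinate field on one common
  chart domain; identities for the curvature operator on fields thereby become identities between
  tangent vectors.\<close>

lemma coord_frame:
  obtains V \<phi> where "(V, \<phi>) \<in> \<A>" "p \<in> V" "\<And>v. v \<in> Tan p \<Longrightarrow> \<exists>w. v = coord_field V \<phi> w p"
  using chart_cover[OF p] Tan_eq_coord_field by blast

lemma Rat_Tan:
  assumes "x \<in> Tan p" "y \<in> Tan p" "z \<in> Tan p"
  shows "Rat x y z \<in> Tan p"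
proof -
  obtain V \<phi> where c: "(V, \<phi>) \<in> \<A>" "p \<in> V" and ex: "\<And>v. v \<in> Tan p \<Longrightarrow> \<exists>w. v = coord_field V \<phi> w p"
    using coord_frame by metis
  obtain u v w where "x = coord_field V \<phi> u p" "y = coord_field V \<phi> v p" "z = coord_field V \<phi> w p"
    using ex assms by metis
  then show ?thesis
    using curvature_at_coord_field[OF c] Rop_Tan[OF chart_openin[OF c(1)] c(2)] coord_field_vfield[OF c(1)] by simp
qed

lemma Rat_skew:
  assumes "x \<in> Tan p" "y \<in> Tan p" "z \<in> Tan p"
  shows "Rat x y z = - Rat y x z" and "g p (Rat x y z) z = 0"
proof -
  obtain V \<phi> where c: "(V, \<phi>) \<in> \<A>" "p \<in> V" and ex: "\<And>v. v \<in> Tan p \<Longrightarrow> \<exists>w. v = coord_field V \<phi> w p"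
    using coord_frame by metis
  obtain u v w where xyz: "x = coord_field V \<phi> u p" "y = coord_field V \<phi> v p" "z = coord_field V \<phi> w p"
    using ex assms by metis
  note V = chart_openin[OF c(1)] and vf = coord_field_vfield[OF c(1)]
  show "Rat x y z = - Rat y x z"
    unfolding xyz curvature_at_coord_field[OF c] by (rule Rop_skew[OF V c(2) vf vf vf])
  show "g p (Rat x y z) z = 0"
    unfolding xyz curvature_at_coord_field[OF c] by (rule Rop_metric_skew[OF V c(2) vf vf vf])
qed

lemma Rat_linear:
  assumes "u \<in> Tan p" "v \<in> Tan p" "x \<in> Tan p" "y \<in> Tan p"
  shows "Rat (a *\<^sub>R u + b *\<^sub>R v) x y = a *\<^sub>R Rat u x y + b *\<^sub>R Rat v x y"
    and "Rat x y (a *\<^sub>R u + b *\<^sub>R v) = a *\<^sub>R Rat x y u + b *\<^sub>R Rat x y v"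
proof -
  obtain V \<phi> where c: "(V, \<phi>) \<in> \<A>" "p \<in> V" and ex: "\<And>v. v \<in> Tan p \<Longrightarrow> \<exists>w. v = coord_field V \<phi> w p"
    using coord_frame by metis
  obtain u' v' x' y' where eqs: "u = coord_field V \<phi> u' p" "v = coord_field V \<phi> v' p"
    "x = coord_field V \<phi> x' p" "y = coord_field V \<phi> y' p"
    using ex assms by metis
  show "Rat (a *\<^sub>R u + b *\<^sub>R v) x y = a *\<^sub>R Rat u x y + b *\<^sub>R Rat v x y"
    unfolding eqs coord_field_linear[OF c, symmetric] curvature_at_coord_field[OF c]
    by (rule Rop_coord_linear[OF c])
  show "Rat x y (a *\<^sub>R u + b *\<^sub>R v) = a *\<^sub>R Rat x y u + b *\<^sub>R Rat x y v"
    unfolding eqs coord_field_linear[OF c, symmetric] curvature_at_coord_field[OF c]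
    by (rule Rop_coord_linear[OF c])
qed

lemma Rat_skew34:
  assumes x: "x \<in> Tan p" and y: "y \<in> Tan p" and z: "z \<in> Tan p" and w: "w \<in> Tan p"
  shows "g p (Rat x y z) w = - g p (Rat x y w) z"
proof -
  note R = Rat_Tan[OF x y z] Rat_Tan[OF x y w]
  \<comment> \<open>Polarisation of \<open>g(R(x, y) z, z) = 0\<close> at \<open>z + w\<close>. The
    unit scalars match the shape of the linearity rules.\<close>
  have zw: "1 *\<^sub>R z + 1 *\<^sub>R w \<in> Tan p" by (rule Tan_combination[OF z w])
  have "0 = g p (Rat x y (1 *\<^sub>R z + 1 *\<^sub>R w)) (1 *\<^sub>R z + 1 *\<^sub>R w)"
    using Rat_skew(2)[OF x y zw] by simp
  also have "\<dots> = g p (Rat x y z) z + g p (Rat x y w) z + (g p (Rat x y z) w + g p (Rat x y w) w)"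
    unfolding Rat_linear(2)[OF z w x y] g_linear[OF p z w Tan_combination[OF R]]
      g_linear_left[OF p R z] g_linear_left[OF p R w] by simp
  finally show ?thesis using Rat_skew(2)[OF x y z] Rat_skew(2)[OF x y w] by simp
qed

text \<open>Two linear conditions on a model space of dimension above 2 have a nonzero common
  solution. The count is made for component vectors \<open>w\<close>, where the dimension is known,
  and then carried to the tangent space by the chart.\<close>

lemma exists_perpendicular:
  assumes dim: "DIM('e) > 2" and x: "x \<in> Tan p" and y: "y \<in> Tan p"
  shows "\<exists>z\<in>Tan p. z \<noteq> 0 \<and> g p x z = 0 \<and> g p y z = 0"
proof -
  obtain V \<phi> where c: "(V, \<phi>) \<in> \<A>" "p \<in> V" using chart_cover[OF p] by blast
  define L where "L w = (g p x (coord_field V \<phi> w p), g p y (coord_field V \<phi> w p))" for w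
  note E = coord_field_Tan[OF c]
  have L2: "L (a *\<^sub>R u + b *\<^sub>R v) = a *\<^sub>R L u + b *\<^sub>R L v" for a b u v
    unfolding L_def coord_field_linear[OF c] g_linear[OF p E E x] g_linear[OF p E E y] by simp
  have lin: "linear L"
    using L2[of 1 _ 1] L2[of _ _ 0] by (intro linearI) auto
  have "\<not> inj L"
  proof
    assume "inj L"
    then have "dim (L ` UNIV) = dim (UNIV :: 'e set)"
      using lin by (intro dim_image_eq) auto
    moreover have "dim (L ` UNIV) \<le> DIM(real \<times> real)" by (rule dim_subset_UNIV)
    ultimately show False using dim by simp
  qed
  then obtain w where w: "w \<noteq> 0" "L w = 0" using lin linear_injective_0 by blast
  then obtain b where b: "b \<in> Basis" "w \<bullet> b \<noteq> 0" using euclidean_all_zero_iff by blast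
  have "coord_field V \<phi> w p \<noteq> 0"
    using coord_field_coordinate[OF c, of w b] b(2) by auto
  then show ?thesis using E w(2) by (auto simp: L_def zero_prod_def)
qed

end

end

theorem theorem5:
  fixes M :: "'a topology"
    and \<A> :: "('a, 'e::euclidean_space) chart set"
    and g :: "'a \<Rightarrow> 'a tvec \<Rightarrow> 'a tvec \<Rightarrow> real"
    and J :: "'a \<Rightarrow> 'a tvec \<Rightarrow> 'a tvec"
    and D :: "'a \<Rightarrow> 'a tvec \<Rightarrow> ('a \<Rightarrow> 'a tvec) \<Rightarrow> 'a tvec"
    and m :: nat
  assumes "DIM('e) = 2 * m" and "m > 1"
    and "almost_hermitian_manifold M \<A> g J"
    and "levi_civita_connection M \<A> g D"
    and "\<forall>p\<in>topspace M. \<exists>c::real.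
      (\<forall>\<alpha>. complex_plane (tangent_space M \<A> p) \<alpha> \<and> holomorphic_plane (J p) \<alpha> \<and>
           signature_pp (g p) \<alpha> \<longrightarrow>
         \<bar>Re (csectional_curvature (g p) (curvature_tensor M \<A> g D p) \<alpha>)\<bar> \<le> c) \<or>
      (\<forall>\<alpha>. complex_plane (tangent_space M \<A> p) \<alpha> \<and> holomorphic_plane (J p) \<alpha> \<and>
           signature_pp (g p) \<alpha> \<longrightarrow>
         \<bar>Im (csectional_curvature (g p) (curvature_tensor M \<A> g D p) \<alpha>)\<bar> \<le> c)"
  shows "pointwise_constant_holomorphic_curvature M \<A> g J D"
  unfolding pointwise_constant_holomorphic_curvature_def
proof
  interpret levi_civita_manifold M \<A> g D
    using assms(3,4) by unfold_locales (auto simp: almost_hermitian_manifold_def)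
  have acs: "almost_complex_structure M \<A> J"
    and gJ: "\<And>p v w. p \<in> topspace M \<Longrightarrow> v \<in> Tan p \<Longrightarrow> w \<in> Tan p \<Longrightarrow> g p (J p v) (J p w) = g p v w"
    using assms(3) unfolding almost_hermitian_manifold_def by auto
  fix p assume p: "p \<in> topspace M"
  have J: "linear_between (Tan p) (Tan p) (J p)" "\<And>v. v \<in> Tan p \<Longrightarrow> J p (J p v) = - v"
    using acs p unfolding almost_complex_structure_def by auto
  \<comment> \<open>All analysis ends here: from the curvature tensor at \<open>p\<close> only
    multilinearity and the two skew symmetries are passed on to the algebra.\<close>
  interpret hermitian_curvature_space "Tan p" "g p" "J p" "curvature_tensor M \<A> g D p"
  proof
    fix x y z w u v :: "'a tvec" and a c :: real
    assume mem: "x \<in> Tan p" "y \<in> Tan p"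
    show "a *\<^sub>R x + c *\<^sub>R y \<in> Tan p" by (rule Tan_combination[OF mem])
    show "g p x y = g p y x" by (rule g_commute[OF p mem])
    show "J p x \<in> Tan p" using J(1) mem unfolding linear_between_def by blast
    show "J p (a *\<^sub>R x + c *\<^sub>R y) = a *\<^sub>R J p x + c *\<^sub>R J p y"
      using J(1) mem unfolding linear_between_def by blast
    show "g p (J p x) (J p y) = g p x y" by (rule gJ[OF p mem])
    assume z: "z \<in> Tan p"
    show "g p z (a *\<^sub>R x + c *\<^sub>R y) = a * g p z x + c * g p z y" by (rule g_linear[OF p mem z])
    assume w: "w \<in> Tan p"
    show "curvature_tensor M \<A> g D p x y z w = - curvature_tensor M \<A> g D p y x z w"
      unfolding curvature_tensor_def Rat_skew(1)[OF p mem z]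
      \<comment> \<open>The negative is written as the combination with coefficients -1 and 0, so
        that linearity in the first argument of the metric yields the sign.\<close>
      using g_linear_left[OF p _ _ w, of "Rat p y x z" "Rat p y x z" "-1" 0] Rat_Tan[OF p mem(2,1) z] by simp
    show "curvature_tensor M \<A> g D p x y z w = - curvature_tensor M \<A> g D p x y w z"
      unfolding curvature_tensor_def by (rule Rat_skew34[OF p mem z w])
    assume u: "u \<in> Tan p"
    show "curvature_tensor M \<A> g D p (a *\<^sub>R x + c *\<^sub>R y) z w u =
        a * curvature_tensor M \<A> g D p x z w u + c * curvature_tensor M \<A> g D p y z w u"
      unfolding curvature_tensor_def Rat_linear(1)[OF p mem z w]
      by (rule g_linear_left[OF p Rat_Tan[OF p mem(1) z w] Rat_Tan[OF p mem(2) z w] u])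
    show "curvature_tensor M \<A> g D p z w (a *\<^sub>R x + c *\<^sub>R y) u =
        a * curvature_tensor M \<A> g D p z w x u + c * curvature_tensor M \<A> g D p z w y u"
      unfolding curvature_tensor_def Rat_linear(2)[OF p mem z w]
      by (rule g_linear_left[OF p Rat_Tan[OF p z w mem(1)] Rat_Tan[OF p z w mem(2)] u])
  qed (use g_pos[OF p] J(2) in auto)
  have "DIM('e) > 2" using assms(1,2) by simp
  then show "\<exists>k. \<forall>x\<in>Tan p. g p x x = 1 \<longrightarrow> curvature_tensor M \<A> g D p x (J p x) (J p x) x = k"
    using H_constant[OF _ exists_perpendicular[OF p]] assms(5) p by (metis (no_types))
qed

end
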